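(* Let $(H,m,1,\Delta,\varepsilon,t,\phi)$ be a biFrobenius algebra of type $S$, with antipode $\mathcal S$, defined over an algebraically closed field $\Bbbk$ of characteristic zero. If $\mathcal S^2=\operatorname{id}$, then $H$ is semisimple (as an algebra) and cosemisimple (as a coalgebra). Conversely, if $H$ is semisimple and cosemisimple, and $\sum \mathcal S(t_2)\,t_1=\varepsilon(t)1$, then $\mathcal S^2=\operatorname{id}$.
   Context: Let $\Bbbk$ be a field, $(H,m,1)$ an associative unital $\Bbbk$-algebra and $(H,\Delta,\varepsilon)$ a coassociative counital $\Bbbk$-coalgebra on the same vector space (no compatibility between $m$ and $\Delta$ is assumed beyond what is stated below). Sweedler notation is used: $\Delta(x)=\sum x_1\otimes x_2$. Actions, for $x,y\in H$, $\lambda\in H^*$: $(\lambda\leftharpoonup x)(y)=\lambda(xy)$ and $x\leftharpoonup\lambda=\sum\lambda(x_1)x_2$. BiFrobenius algebra: let $\phi\in H^*$ and $t\in H$. The tuple $(H,m,1,\Delta,\varepsilon,t,\phi)$ is a biFrobenius algebra if: (1) $H^*=\phi\leftharpoonup H$ (Frobenius algebra) and $H=t\leftharpoonup H^*$ (coFrobenius coalgebra); in particular $H$ is finite dimensional; (2) $1$ is a group-like element ($\Delta(1)=1\otimes 1$, $\varepsilon(1)=1$) and $\varepsilon$ is an algebra homomorphism; (3) $t\leftharpoonup\phi=1$ and $\phi\leftharpoonup t=\varepsilon$; then $tx=\varepsilon(x)t$ and $\phi(x)1=\sum\phi(x_1)x_2$ for all $x\in H$, and $\phi(t)=1$; (4)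 the map $\mathcal S:H\to H$, $\mathcal S(x)=\sum\phi(t_1x)t_2$ (the antipode), is an antiautomorphism of algebras and of coalgebras. The biFrobenius algebra $H$ is of type $S$ (an SbF algebra) if $\mathcal S$ is the convolution inverse of the identity in $\operatorname{End}_\Bbbk(H)$, i.e. $\sum\mathcal S(x_1)x_2=\sum x_1\mathcal S(x_2)=\varepsilon(x)1$ for all $x\in H$. *)

theory Defs
  imports "HOL-Library.Poly_Mapping" "HOL-Computational_Algebra.Polynomial"
begin

section \<open>Free vector spaces\<close>

definition free_scale :: "'k::field \<Rightarrow> ('i \<Rightarrow>\<^sub>0 'k) \<Rightarrow> ('i \<Rightarrow>\<^sub>0 'k)"
  where "free_scale c u = Poly_Mapping.map ((*) c) u"

definition basis_vec :: "'i \<Rightarrow> ('i \<Rightarrow>\<^sub>0 'k::field)"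
  where "basis_vec i = Poly_Mapping.single i 1"

lemma lookup_free_scale [simp]: "Poly_Mapping.lookup (free_scale c u) i = c * Poly_Mapping.lookup u i"
  by (simp add: free_scale_def map.rep_eq when_def)

global_interpretation free: vector_space "free_scale :: 'k::field \<Rightarrow> ('i \<Rightarrow>\<^sub>0 'k) \<Rightarrow> _"
  by unfold_locales (auto intro!: poly_mapping_eqI simp: lookup_add algebra_simps)

text \<open>Linear extension of \<open>f\<close> from the basis, with values in a space with scalar
  multiplication \<open>s\<close>.\<close>

definition lin_ext :: "('k::field \<Rightarrow> 'v \<Rightarrow> 'v) \<Rightarrow> ('i \<Rightarrow> 'v) \<Rightarrow> ('i \<Rightarrow>\<^sub>0 'k) \<Rightarrow> 'v::ab_group_add"
  where "lin_ext s f u = (\<Sum>i\<in>Poly_Mapping.keys u. s (Poly_Mapping.lookup u i) (f i))"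

lemma (in vector_space) lin_ext_superset:
  assumes "finite A" "Poly_Mapping.keys u \<subseteq> A"
  shows "lin_ext scale f u = (\<Sum>i\<in>A. scale (Poly_Mapping.lookup u i) (f i))"
  unfolding lin_ext_def
  by (rule sum.mono_neutral_left) (use assms in \<open>auto simp: in_keys_iff\<close>)

lemma (in vector_space) lin_ext_basis_vec [simp]: "lin_ext scale f (basis_vec i) = f i"
  by (simp add: lin_ext_def basis_vec_def)

lemma (in vector_space) linear_lin_ext: "Vector_Spaces.linear free_scale scale (lin_ext scale f)"
proof (unfold_locales)
  fix u v :: "'c \<Rightarrow>\<^sub>0 'a" and c :: 'a
  let ?A = "Poly_Mapping.keys u \<union> Poly_Mapping.keys v"
  have "Poly_Mapping.keys (u + v) \<subseteq> ?A"
    by (rule Poly_Mapping.keys_add)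
  then show "lin_ext scale f (u + v) = lin_ext scale f u + lin_ext scale f v"
    by (simp add: lin_ext_superset[of ?A] lookup_add scale_left_distrib sum.distrib)
  have "Poly_Mapping.keys (free_scale c u) \<subseteq> Poly_Mapping.keys u"
    by (auto simp: in_keys_iff)
  then show "lin_ext scale f (free_scale c u) = scale c (lin_ext scale f u)"
    by (simp add: lin_ext_superset[of "Poly_Mapping.keys u"] scale_sum_right)
qed


section \<open>Tensor products\<close>

text \<open>The tensor square of a vector space on the type \<open>'b\<close> is the free vector space on
  \<open>'b \<times> 'b\<close> modulo the relations that make \<open>(x, y) \<mapsto> x \<otimes> y\<close> additive and homogeneous in each
  argument; the tensor cube is obtained in the same way from \<open>'b \<times> 'b \<times> 'b\<close>. As the relations
  depend on the scalar multiplication, the quotients are not types. Tensors are instead given by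
  formal linear combinations of pairs (triples), and equality of tensors is the congruence
  \<open>\<approx>\<^sub>2\<close> (\<open>\<approx>\<^sub>3\<close>). A slot is a map that fills in one of the arguments, the others being fixed.\<close>

definition slots2 :: "('b \<Rightarrow> 'b \<times> 'b) set"
  where "slots2 = {\<lambda>x. (x, b) | b. True} \<union> {\<lambda>x. (a, x) | a. True}"

definition slots3 :: "('b \<Rightarrow> 'b \<times> 'b \<times> 'b) set"
  where "slots3 = {\<lambda>x. (x, b, c) | b c. True} \<union> {\<lambda>x. (a, x, c) | a c. True}
    \<union> {\<lambda>x. (a, b, x) | a b. True}"

locale tensor_space = vector_space scale
  for scale :: "'a::field \<Rightarrow> 'b::ab_group_add \<Rightarrow> 'b" (infixr \<open>\<odot>\<close> 75)
begin

definition multilinear_relations :: "('b \<Rightarrow> 'i) set \<Rightarrow> ('i \<Rightarrow>\<^sub>0 'a) set"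
  where "multilinear_relations F =
    {basis_vec (f (x + y)) - basis_vec (f x) - basis_vec (f y) | f x y. f \<in> F}
    \<union> {basis_vec (f (c \<odot> x)) - free_scale c (basis_vec (f x)) | f c x. f \<in> F}"

definition tensor2_eq :: "('b \<times> 'b \<Rightarrow>\<^sub>0 'a) \<Rightarrow> ('b \<times> 'b \<Rightarrow>\<^sub>0 'a) \<Rightarrow> bool"  (infix "\<approx>\<^sub>2" 50)
  where "u \<approx>\<^sub>2 v \<longleftrightarrow> u - v \<in> free.span (multilinear_relations slots2)"

definition tensor3_eq ::
    "('b \<times> 'b \<times> 'b \<Rightarrow>\<^sub>0 'a) \<Rightarrow> ('b \<times> 'b \<times> 'b \<Rightarrow>\<^sub>0 'a) \<Rightarrow> bool"  (infix "\<approx>\<^sub>3" 50)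
  where "u \<approx>\<^sub>3 v \<longleftrightarrow> u - v \<in> free.span (multilinear_relations slots3)"

text \<open>Bilinear maps are well defined on tensors, so sums in Sweedler notation do not depend on
  the chosen representatives.\<close>

lemma lin_ext_tensor2_eq:
  assumes "u \<approx>\<^sub>2 v"
    and "\<And>a. Vector_Spaces.linear (\<odot>) (\<odot>) (B a)"
    and "\<And>b. Vector_Spaces.linear (\<odot>) (\<odot>) (\<lambda>a. B a b)"
  shows "lin_ext (\<odot>) (\<lambda>(a, b). B a b) u = lin_ext (\<odot>) (\<lambda>(a, b). B a b) v"
proof -
  let ?L = "lin_ext (\<odot>) (\<lambda>(a, b). B a b)"
  interpret L: Vector_Spaces.linear free_scale "(\<odot>)" ?L
    by (rule linear_lin_ext)
  have B1: "B a (x + y) = B a x + B a y" "B a (c \<odot> x) = c \<odot> B a x" for a x y c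
  proof -
    interpret Vector_Spaces.linear "(\<odot>)" "(\<odot>)" "B a" by (rule assms)
    show "B a (x + y) = B a x + B a y" "B a (c \<odot> x) = c \<odot> B a x"
      by (rule add, rule scale)
  qed
  have B2: "B (x + y) b = B x b + B y b" "B (c \<odot> x) b = c \<odot> B x b" for b x y c
  proof -
    interpret Vector_Spaces.linear "(\<odot>)" "(\<odot>)" "\<lambda>a. B a b" by (rule assms)
    show "B (x + y) b = B x b + B y b" "B (c \<odot> x) b = c \<odot> B x b"
      by (rule add, rule scale)
  qed
  have "?L r = 0" if "r \<in> multilinear_relations slots2" for r
    using that unfolding multilinear_relations_def slots2_def
    by (auto simp: L.diff L.scale B1 B2)
  then have "?L (u - v) = 0"
    using assms(1) unfolding tensor2_eq_def by (rule L.eq_0_on_span)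
  then show ?thesis by (simp add: L.diff)
qed

end


section \<open>Algebras and coalgebras\<close>

locale k_algebra = tensor_space scale
  for scale :: "'k::field \<Rightarrow> 'h::ring_1 \<Rightarrow> 'h" (infixr \<open>\<odot>\<close> 75) +
  assumes mult_scale_left: "(c \<odot> x) * y = c \<odot> (x * y)"
    and mult_scale_right: "x * (c \<odot> y) = c \<odot> (x * y)"
begin

definition left_ideal :: "'h set \<Rightarrow> bool"
  where "left_ideal I \<longleftrightarrow> subspace I \<and> (\<forall>a. \<forall>x\<in>I. a * x \<in> I)"

definition simple_left_ideal :: "'h set \<Rightarrow> bool"
  where "simple_left_ideal I \<longleftrightarrow>
    left_ideal I \<and> I \<noteq> {0} \<and> (\<forall>J. left_ideal J \<and> J \<subseteq> I \<longrightarrow> J = {0} \<or> J = I)"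

text \<open>The left regular module is a semisimple module, that is, a sum of simple submodules.\<close>

definition semisimple :: bool
  where "semisimple \<longleftrightarrow> span (\<Union>{I. simple_left_ideal I}) = UNIV"

end

text \<open>\<open>\<Delta> x\<close> is a representative of the tensor \<open>\<Delta>(x)\<close>, which is why linearity, coassociativity
  and other identities between tensors are required up to \<open>\<approx>\<^sub>2\<close> and \<open>\<approx>\<^sub>3\<close> only.\<close>

locale coalgebra = tensor_space scale
  for scale :: "'k::field \<Rightarrow> 'h::ab_group_add \<Rightarrow> 'h" (infixr \<open>\<odot>\<close> 75) +
  fixes \<Delta> :: "'h \<Rightarrow> ('h \<times> 'h \<Rightarrow>\<^sub>0 'k)"
    and \<epsilon> :: "'h \<Rightarrow> 'k"
  assumes comult_add: "\<Delta> (x + y) \<approx>\<^sub>2 \<Delta> x + \<Delta> y"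
    and comult_scale: "\<Delta> (c \<odot> x) \<approx>\<^sub>2 free_scale c (\<Delta> x)"
    and linear_counit: "Vector_Spaces.linear (\<odot>) (*) \<epsilon>"
    and coassoc:
      "lin_ext free_scale (\<lambda>(a, b). lin_ext free_scale (\<lambda>(p, q). basis_vec (p, q, b)) (\<Delta> a)) (\<Delta> x)
       \<approx>\<^sub>3
       lin_ext free_scale (\<lambda>(a, b). lin_ext free_scale (\<lambda>(p, q). basis_vec (a, p, q)) (\<Delta> b)) (\<Delta> x)"
    and counit_left: "lin_ext (\<odot>) (\<lambda>(a, b). \<epsilon> a \<odot> b) (\<Delta> x) = x"
    and counit_right: "lin_ext (\<odot>) (\<lambda>(a, b). \<epsilon> b \<odot> a) (\<Delta> x) = x"
begin

text \<open>\<open>sweedler B x\<close> is the sum of all \<open>B x\<^sub>1 x\<^sub>2\<close> in Sweedler notation.\<close>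

definition sweedler :: "('h \<Rightarrow> 'h \<Rightarrow> 'h) \<Rightarrow> 'h \<Rightarrow> 'h"
  where "sweedler B x = lin_ext (\<odot>) (\<lambda>(a, b). B a b) (\<Delta> x)"

definition subcoalgebra :: "'h set \<Rightarrow> bool"
  where "subcoalgebra D \<longleftrightarrow>
    subspace D \<and> (\<forall>x\<in>D. \<exists>u. Poly_Mapping.keys u \<subseteq> D \<times> D \<and> \<Delta> x \<approx>\<^sub>2 u)"

definition simple_subcoalgebra :: "'h set \<Rightarrow> bool"
  where "simple_subcoalgebra D \<longleftrightarrow>
    subcoalgebra D \<and> D \<noteq> {0} \<and> (\<forall>E. subcoalgebra E \<and> E \<subseteq> D \<longrightarrow> E = {0} \<or> E = D)"

text \<open>The coalgebra is the sum of its simple subcoalgebras.\<close>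

definition cosemisimple :: bool
  where "cosemisimple \<longleftrightarrow> span (\<Union>{D. simple_subcoalgebra D}) = UNIV"

definition coact :: "'h \<Rightarrow> ('h \<Rightarrow> 'k) \<Rightarrow> 'h"  (infixl \<open>\<leftharpoonup>\<^sub>c\<close> 70)
  where "x \<leftharpoonup>\<^sub>c f = sweedler (\<lambda>a b. f a \<odot> b) x"

end


section \<open>BiFrobenius algebras\<close>

locale algebra_coalgebra =
  k_algebra scale + coalgebra scale \<Delta> \<epsilon>
  for scale :: "'k::field \<Rightarrow> 'h::ring_1 \<Rightarrow> 'h" (infixr \<open>\<odot>\<close> 75)
    and \<Delta> :: "'h \<Rightarrow> ('h \<times> 'h \<Rightarrow>\<^sub>0 'k)"
    and \<epsilon> :: "'h \<Rightarrow> 'k"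
begin

abbreviation dual_space :: "('h \<Rightarrow> 'k) set"
  where "dual_space \<equiv> {f. Vector_Spaces.linear (\<odot>) (*) f}"

definition act :: "('h \<Rightarrow> 'k) \<Rightarrow> 'h \<Rightarrow> ('h \<Rightarrow> 'k)"  (infixl \<open>\<leftharpoonup>\<^sub>a\<close> 70)
  where "f \<leftharpoonup>\<^sub>a x = (\<lambda>y. f (x * y))"

definition antipode :: "'h \<Rightarrow> ('h \<Rightarrow> 'k) \<Rightarrow> 'h \<Rightarrow> 'h"
  where "antipode t \<phi> x = sweedler (\<lambda>a b. \<phi> (a * x) \<odot> b) t"

definition algebra_antiautomorphism :: "('h \<Rightarrow> 'h) \<Rightarrow> bool"
  where "algebra_antiautomorphism S \<longleftrightarrow>
    Vector_Spaces.linear (\<odot>) (\<odot>) S \<and> bij S \<and> S 1 = 1 \<and> (\<forall>x y. S (x * y) = S y * S x)"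

definition coalgebra_antiautomorphism :: "('h \<Rightarrow> 'h) \<Rightarrow> bool"
  where "coalgebra_antiautomorphism S \<longleftrightarrow>
    Vector_Spaces.linear (\<odot>) (\<odot>) S \<and> bij S \<and> (\<forall>x. \<epsilon> (S x) = \<epsilon> x) \<and>
    (\<forall>x. \<Delta> (S x) \<approx>\<^sub>2 lin_ext free_scale (\<lambda>(a, b). basis_vec (S b, S a)) (\<Delta> x))"

end

locale bifrobenius_algebra = algebra_coalgebra scale \<Delta> \<epsilon>
  for scale :: "'k::field \<Rightarrow> 'h::ring_1 \<Rightarrow> 'h" (infixr \<open>\<odot>\<close> 75)
    and \<Delta> :: "'h \<Rightarrow> ('h \<times> 'h \<Rightarrow>\<^sub>0 'k)"
    and \<epsilon> :: "'h \<Rightarrow> 'k" +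
  fixes t :: 'h
    and \<phi> :: "'h \<Rightarrow> 'k"
  assumes linear_phi: "\<phi> \<in> dual_space"
    and frobenius: "dual_space = range (\<lambda>x. \<phi> \<leftharpoonup>\<^sub>a x)"
    and cofrobenius: "UNIV = (\<lambda>f. t \<leftharpoonup>\<^sub>c f) ` dual_space"
    and one_grouplike: "\<Delta> 1 \<approx>\<^sub>2 basis_vec (1, 1)" "\<epsilon> 1 = 1"
    and counit_mult: "\<epsilon> (x * y) = \<epsilon> x * \<epsilon> y"
    and coact_phi: "t \<leftharpoonup>\<^sub>c \<phi> = 1"
    and act_t: "\<phi> \<leftharpoonup>\<^sub>a t = \<epsilon>"
    and antipode_algebra: "algebra_antiautomorphism (antipode t \<phi>)"
    and antipode_coalgebra: "coalgebra_antiautomorphism (antipode t \<phi>)"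

text \<open>Type S: the antipode is the convolution inverse of the identity.\<close>

locale sbf_algebra = bifrobenius_algebra scale \<Delta> \<epsilon> t \<phi>
  for scale :: "'k::field \<Rightarrow> 'h::ring_1 \<Rightarrow> 'h" (infixr \<open>\<odot>\<close> 75)
    and \<Delta> :: "'h \<Rightarrow> ('h \<times> 'h \<Rightarrow>\<^sub>0 'k)"
    and \<epsilon> :: "'h \<Rightarrow> 'k"
    and t :: 'h
    and \<phi> :: "'h \<Rightarrow> 'k" +
  assumes antipode_left: "sweedler (\<lambda>a b. antipode t \<phi> a * b) x = \<epsilon> x \<odot> 1"
    and antipode_right: "sweedler (\<lambda>a b. a * antipode t \<phi> b) x = \<epsilon> x \<odot> 1"

end

theory Submission
  imports Defs
begin

text \<open>
  By definition of the antipode, \<open>x = \<Sum> \<phi>(t\<^sub>1 x) S\<^sup>-\<^sup>1(t\<^sub>2)\<close>, so \<open>\<Sum> S\<^sup>-\<^sup>1(t\<^sub>2) \<otimes> t\<^sub>1\<close> is the Casimir element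
  of the Frobenius form \<open>\<phi>\<close>. In type \<open>S\<close> its product is \<open>\<epsilon>(t)1\<close>, so Maschke's averaging argument
  gives semisimplicity as soon as \<open>\<epsilon>(t) \<noteq> 0\<close>. Dually, \<open>\<sigma>(x, y) = \<phi>(x S\<^sup>-\<^sup>1(y))\<close> satisfies
  \<open>\<Sum> \<sigma>(x\<^sub>1, y) x\<^sub>2 = \<Sum> \<sigma>(x, y\<^sub>2) y\<^sub>1\<close> and \<open>\<Sum> \<sigma>(x\<^sub>2, x\<^sub>1) = \<epsilon>(x)\<phi>(1)\<close>, so \<open>H\<close> is cosemisimple as soon as
  \<open>\<phi>(1) \<noteq> 0\<close>. If \<open>S\<^sup>2 = id\<close>, the trace of the identity is \<open>\<Sum> \<phi>(t\<^sub>1 S(t\<^sub>2)) = \<epsilon>(t)\<phi>(1)\<close>, which is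
  therefore \<open>dim H \<noteq> 0\<close>.

  Conversely, a simple left ideal not contained in the kernel of \<open>\<epsilon>\<close> shows \<open>\<epsilon>(t) \<noteq> 0\<close>. The Casimir
  property yields \<open>S\<^sup>2(y) z = z y\<close> for \<open>z = \<Sum> S(t\<^sub>2) t\<^sub>1\<close>, so \<open>S\<^sup>2 = id\<close> when \<open>z = \<epsilon>(t)1\<close>.
\<close>

section \<open>Averaging projections\<close>

lemma linear_sum:
  assumes "Vector_Spaces.linear s1 s2 f"
  shows "f (sum g A) = (\<Sum>i\<in>A. f (g i))"
  using assms by (simp add: linear_iff_module_hom module_hom.sum)

lemma linear_zero:
  assumes "Vector_Spaces.linear s1 s2 f"
  shows "f 0 = 0"
  using assms by (simp add: linear_iff_module_hom module_hom.zero)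

lemma linear_diff:
  assumes "Vector_Spaces.linear s1 s2 f"
  shows "f (x - y) = f x - f y"
  using assms by (simp add: linear_iff_module_hom module_hom.diff)

lemma linear_lin_ext_comp:
  assumes "Vector_Spaces.linear s1 s2 G"
  shows "G (lin_ext s1 F u) = lin_ext s2 (\<lambda>i. G (F i)) u"
  unfolding lin_ext_def linear_sum[OF assms] using assms by (simp add: Vector_Spaces.linear_iff)

lemma vector_space_mult: "vector_space ((*) :: 'k::field \<Rightarrow> 'k \<Rightarrow> 'k)"
  by unfold_locales (auto simp: algebra_simps)

context vector_space
begin

lemma linear_self_iff:
  "Vector_Spaces.linear scale scale f \<longleftrightarrow>
    (\<forall>x y. f (x + y) = f x + f y) \<and> (\<forall>c x. f (c *s x) = c *s f x)"
  using vector_space_axioms by (auto simp: Vector_Spaces.linear_iff)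

lemma linear_functional_iff:
  "Vector_Spaces.linear scale (*) f \<longleftrightarrow>
    (\<forall>x y. f (x + y) = f x + f y) \<and> (\<forall>c x. f (c *s x) = c * f x)"
  using vector_space_axioms vector_space_mult by (auto simp: Vector_Spaces.linear_iff)

end

section \<open>Stable subspaces and projections commuting with operators\<close>

context tensor_space
begin

abbreviation functional :: "('b \<Rightarrow> 'a) \<Rightarrow> bool"
  where "functional f \<equiv> Vector_Spaces.linear (\<odot>) (*) f"

text \<open>One notion serves algebra and coalgebra: for the left multiplications the stable
  subspaces are the left ideals, for the two actions of the dual space they are the
  subcoalgebras.\<close>

definition stable :: "('b \<Rightarrow> 'b) set \<Rightarrow> 'b set \<Rightarrow> bool"
  where "stable \<Omega> V \<longleftrightarrow> subspace V \<and> (\<forall>T\<in>\<Omega>. \<forall>x\<in>V. T x \<in> V)"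

definition simple_stable :: "('b \<Rightarrow> 'b) set \<Rightarrow> 'b set \<Rightarrow> bool"
  where "simple_stable \<Omega> V \<longleftrightarrow>
    stable \<Omega> V \<and> V \<noteq> {0} \<and> (\<forall>W. stable \<Omega> W \<and> W \<subseteq> V \<longrightarrow> W = {0} \<or> W = V)"

definition equivariant_projection :: "('b \<Rightarrow> 'b) set \<Rightarrow> 'b set \<Rightarrow> ('b \<Rightarrow> 'b) \<Rightarrow> bool"
  where "equivariant_projection \<Omega> V p \<longleftrightarrow>
    Vector_Spaces.linear scale scale p \<and> (\<forall>x. p x \<in> V) \<and> (\<forall>x\<in>V. p x = x) \<and>
    (\<forall>T\<in>\<Omega>. \<forall>x. T (p x) = p (T x))"

lemma exists_projection:
  assumes "subspace V"
  obtains p where "equivariant_projection {} V p"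
proof -
  interpret vector_space_pair scale scale ..
  from linear_exists_left_inverse_on[OF linear_ident assms]
  show thesis
    using that by (auto simp: equivariant_projection_def image_subset_iff)
qed

text \<open>The families \<open>A\<close> and \<open>B\<close> behave like dual bases: the operators in \<open>\<Omega>\<close> act on them by
  mutually transposed matrices.\<close>

lemma average_projection:
  assumes p: "equivariant_projection \<Omega>' V p"
    and V: "subspace V"
    and lin: "\<And>i. i \<in> J \<Longrightarrow> Vector_Spaces.linear scale scale (A i)"
      "\<And>i. i \<in> J \<Longrightarrow> Vector_Spaces.linear scale scale (B i)"
      "\<And>T. T \<in> \<Omega> \<union> \<Omega>' \<Longrightarrow> Vector_Spaces.linear scale scale T"
    and stab: "\<And>i x. i \<in> J \<Longrightarrow> x \<in> V \<Longrightarrow> A i x \<in> V" "\<And>i x. i \<in> J \<Longrightarrow> x \<in> V \<Longrightarrow> B i x \<in> V"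
    and one: "\<And>x. (\<Sum>i\<in>J. B i (A i x)) = x"
    and dual: "\<And>T. T \<in> \<Omega> \<Longrightarrow> \<exists>m. \<forall>i\<in>J. \<forall>x.
      T (B i x) = (\<Sum>j\<in>J. m j i \<odot> B j x) \<and> A i (T x) = (\<Sum>j\<in>J. m i j \<odot> A j x)"
    and comm: "\<And>T i x. T \<in> \<Omega>' \<Longrightarrow> i \<in> J \<Longrightarrow> A i (T x) = T (A i x)"
      "\<And>T i x. T \<in> \<Omega>' \<Longrightarrow> i \<in> J \<Longrightarrow> B i (T x) = T (B i x)"
  shows "equivariant_projection (\<Omega> \<union> \<Omega>') V (\<lambda>x. \<Sum>i\<in>J. B i (p (A i x)))"
  unfolding equivariant_projection_def
proof (intro conjI ballI allI)
  have lp: "Vector_Spaces.linear scale scale p" and pV: "\<And>x. p x \<in> V"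
    and pid: "\<And>x. x \<in> V \<Longrightarrow> p x = x" and pT: "\<And>T x. T \<in> \<Omega>' \<Longrightarrow> T (p x) = p (T x)"
    using p by (auto simp: equivariant_projection_def)
  have pscale: "p (c \<odot> x) = c \<odot> p x" for c x
    using lp by (simp add: linear_self_iff)
  have Bscale: "B i (c \<odot> x) = c \<odot> B i x" if "i \<in> J" for i c x
    using lin(2)[OF that] by (simp add: linear_self_iff)
  show "Vector_Spaces.linear scale scale (\<lambda>x. \<Sum>i\<in>J. B i (p (A i x)))"
    using lp lin(1,2) by (simp add: linear_self_iff sum.distrib scale_sum_right)
  show "(\<Sum>i\<in>J. B i (p (A i x))) \<in> V" for x
    by (intro subspace_sum V stab pV)
  show "(\<Sum>i\<in>J. B i (p (A i x))) = x" if "x \<in> V" for x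
    using one[of x] that by (simp add: pid stab)
  fix T x
  assume "T \<in> \<Omega> \<union> \<Omega>'"
  then have lT: "Vector_Spaces.linear scale scale T" by (rule lin(3))
  show "T (\<Sum>i\<in>J. B i (p (A i x))) = (\<Sum>i\<in>J. B i (p (A i (T x))))"
  proof (cases "T \<in> \<Omega>'")
    \<comment> \<open>Operators in \<open>\<Omega>'\<close> commute with \<open>p\<close> and with
      both families, hence also with the average. This is what allows averaging a second time over
      other operators.\<close>
    case True
    then show ?thesis
      by (simp add: linear_sum[OF lT] comm[of T] flip: pT[of T])
  next
    case False
    then obtain m where
      B: "\<And>i x. i \<in> J \<Longrightarrow> T (B i x) = (\<Sum>j\<in>J. m j i \<odot> B j x)" and
      A: "\<And>i x. i \<in> J \<Longrightarrow> A i (T x) = (\<Sum>j\<in>J. m i j \<odot> A j x)"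
      using dual[of T] \<open>T \<in> \<Omega> \<union> \<Omega>'\<close> by blast
    \<comment> \<open>The matrix that \<open>T\<close> produces on the \<open>B\<close> side passes
      through the linear maps \<open>B j\<close> and \<open>p\<close> and becomes the action of
      \<open>T\<close> on the \<open>A\<close> side.\<close>
    have "T (\<Sum>i\<in>J. B i (p (A i x))) = (\<Sum>i\<in>J. \<Sum>j\<in>J. m j i \<odot> B j (p (A i x)))"
      by (simp add: linear_sum[OF lT] B)
    also have "\<dots> = (\<Sum>j\<in>J. B j (p (\<Sum>i\<in>J. m j i \<odot> A i x)))"
      by (subst sum.swap, intro sum.cong refl)
        (simp add: linear_sum[OF lp] linear_sum[OF lin(2)] pscale Bscale)
    also have "\<dots> = (\<Sum>j\<in>J. B j (p (A j (T x))))"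
      by (simp add: A)
    finally show ?thesis .
  qed
qed

lemma span_stable:
  assumes "\<And>T. T \<in> \<Omega> \<Longrightarrow> Vector_Spaces.linear scale scale T"
    and "\<And>V. V \<in> \<V> \<Longrightarrow> stable \<Omega> V"
  shows "stable \<Omega> (span (\<Union>\<V>))"
  unfolding stable_def
proof (intro conjI ballI subspace_span)
  fix T x
  assume T: "T \<in> \<Omega>" and x: "x \<in> span (\<Union>\<V>)"
  have lT: "Vector_Spaces.linear scale scale T" using assms(1) T .
  show "T x \<in> span (\<Union>\<V>)"
    using x
  proof (induction rule: span_induct_alt)
    case base
    then show ?case by (simp add: linear_zero[OF lT] span_zero)
  next
    case (step c y z)
    then have "T y \<in> \<Union>\<V>"
      using assms(2) T by (auto simp: stable_def)
    with step show ?case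
      using lT by (simp add: linear_self_iff span_add span_scale span_base)
  qed
qed

end

section \<open>Finite dimension: coordinates and complete reducibility\<close>

locale fd_space = tensor_space scale + finite_dimensional_vector_space scale Basis
  for scale :: "'a::field \<Rightarrow> 'b::ab_group_add \<Rightarrow> 'b" (infixr \<open>\<odot>\<close> 75) and Basis
begin

text \<open>The dual basis; \<open>coord b\<close> is the zero functional when \<open>b\<close> is
  not in \<open>Basis\<close>.\<close>

definition coord :: "'b \<Rightarrow> 'b \<Rightarrow> 'a"
  where "coord b x = representation Basis x b"

lemma linear_coord: "Vector_Spaces.linear scale (*) (coord b)"
  unfolding coord_def[abs_def] by (rule linear_representation) (auto simp: independent_Basis span_Basis)

lemma sum_coord: "(\<Sum>b\<in>Basis. coord b x \<odot> b) = x"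
  unfolding coord_def
  by (rule sum_representation_eq) (auto simp: independent_Basis span_Basis finite_Basis)

lemma coord_Basis: "b \<in> Basis \<Longrightarrow> coord c b = (if c = b then 1 else 0)"
  by (simp add: coord_def representation_basis independent_Basis)

lemma sum_coord_functional:
  assumes "Vector_Spaces.linear scale (*) f"
  shows "(\<Sum>b\<in>Basis. coord b x * f b) = f x"
proof -
  have "f x = f (\<Sum>b\<in>Basis. coord b x \<odot> b)" by (simp add: sum_coord)
  also have "\<dots> = (\<Sum>b\<in>Basis. coord b x * f b)"
    unfolding linear_sum[OF assms] using assms by (simp add: linear_functional_iff)
  finally show ?thesis by simp
qed

text \<open>Coordinates determine a vector. This reduces identities in the coalgebra to identities
  of scalars, where the two actions of the dual space can be exchanged.\<close>

lemma functionals_separate: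
  assumes "\<And>f. Vector_Spaces.linear scale (*) f \<Longrightarrow> f x = f y"
  shows "x = y"
proof -
  have "coord b x = coord b y" for b
    using linear_coord by (rule assms)
  then have "(\<Sum>b\<in>Basis. coord b x \<odot> b) = (\<Sum>b\<in>Basis. coord b y \<odot> b)" by simp
  then show ?thesis by (simp only: sum_coord)
qed

text \<open>Let \<open>M\<close> be the sum of the simple stable subspaces. The kernel
  \<open>N\<close> of an equivariant projection onto \<open>M\<close> is stable and meets
  \<open>M\<close> only in \<open>0\<close>. If \<open>N\<close> were nonzero, a nonzero stable
  subspace of least dimension in it would be simple, hence inside \<open>M\<close>, which is
  absurd.\<close>

lemma span_simple_stable:
  assumes lin: "\<And>T. T \<in> \<Omega> \<Longrightarrow> Vector_Spaces.linear scale scale T"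
    and proj: "\<And>V. stable \<Omega> V \<Longrightarrow> \<exists>p. equivariant_projection \<Omega> V p"
  shows "span (\<Union>{V. simple_stable \<Omega> V}) = UNIV"
proof -
  define M where "M = span (\<Union>{V. simple_stable \<Omega> V})"
  have "stable \<Omega> M"
    unfolding M_def by (rule span_stable[OF lin]) (auto simp: simple_stable_def)
  then obtain p where lp: "Vector_Spaces.linear scale scale p" and pM: "\<And>x. p x \<in> M"
    and pid: "\<And>x. x \<in> M \<Longrightarrow> p x = x" and pT: "\<And>T x. T \<in> \<Omega> \<Longrightarrow> T (p x) = p (T x)"
    using proj unfolding equivariant_projection_def by blast
  define N where "N = {x. p x = 0}"
  have "p (T x) = 0" if "T \<in> \<Omega>" "p x = 0" for T x
    using that pT[of T x] linear_zero[OF lin] by metis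
  then have N: "stable \<Omega> N"
    using lp linear_zero[OF lp] by (auto simp: stable_def subspace_def N_def linear_self_iff)
  have "N = {0}"
  proof (rule ccontr)
    assume "N \<noteq> {0}"
    let ?P = "\<lambda>V. stable \<Omega> V \<and> V \<noteq> {0} \<and> V \<subseteq> N"
    have "?P N" using N \<open>N \<noteq> {0}\<close> by blast
    then obtain V where V: "?P V" and least: "\<And>W. ?P W \<Longrightarrow> dim V \<le> dim W"
      using ex_has_least_nat[of ?P N dim] by blast
    have "W = V" if "stable \<Omega> W" "W \<subseteq> V" "W \<noteq> {0}" for W
    proof (rule subspace_dim_equal)
      show "dim V \<le> dim W" using that V by (intro least) blast
    qed (use that V in \<open>simp_all add: stable_def\<close>)
    then have "simple_stable \<Omega> V"
      using V by (auto simp: simple_stable_def)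
    then have "V \<subseteq> M"
      unfolding M_def by (auto intro: span_base)
    then have "V \<subseteq> {0}"
      using V pid by (force simp: N_def)
    then show False
      using V subspace_0[of V] by (auto simp: stable_def)
  qed
  have "x \<in> M" for x
  proof -
    have "x - p x \<in> N"
      by (simp add: N_def linear_diff[OF lp] pid pM)
    then show ?thesis using \<open>N = {0}\<close> pM[of x] by simp
  qed
  then show ?thesis unfolding M_def by blast
qed

end

section \<open>Coalgebras\<close>

lemma (in tensor_space) lin_ext_tensor3_eq:
  assumes "u \<approx>\<^sub>3 v"
    and B: "\<And>F. F \<in> slots3 \<Longrightarrow> Vector_Spaces.linear (\<odot>) (\<odot>) (\<lambda>x. B (F x))"
  shows "lin_ext (\<odot>) B u = lin_ext (\<odot>) B v"
proof -
  interpret L: Vector_Spaces.linear free_scale "(\<odot>)" "lin_ext (\<odot>) B"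
    by (rule linear_lin_ext)
  have "lin_ext (\<odot>) B r = 0" if "r \<in> multilinear_relations slots3" for r
  proof -
    \<comment> \<open>Every generator of the relations comes from a single slot, and linearity in
      that slot sends it to \<open>0\<close>.\<close>
    from that obtain F where F: "F \<in> slots3" and
      "(\<exists>x y. r = basis_vec (F (x + y)) - basis_vec (F x) - basis_vec (F y)) \<or>
       (\<exists>c x. r = basis_vec (F (c \<odot> x)) - free_scale c (basis_vec (F x)))"
      unfolding multilinear_relations_def by blast
    then show ?thesis
      using B[OF F] by (auto simp: L.diff L.scale linear_self_iff)
  qed
  then have "lin_ext (\<odot>) B (u - v) = 0"
    using assms(1) unfolding tensor3_eq_def by (rule L.eq_0_on_span)
  then show ?thesis by (simp add: L.diff)
qed

lemma (in tensor_space) tensor2_eq_refl: "u \<approx>\<^sub>2 u"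
  by (simp add: tensor2_eq_def free.span_zero)

lemma (in tensor_space) tensor2_eq_trans [trans]: "u \<approx>\<^sub>2 v \<Longrightarrow> v \<approx>\<^sub>2 w \<Longrightarrow> u \<approx>\<^sub>2 w"
  unfolding tensor2_eq_def using free.span_add[of "u - v" _ "v - w"] by simp

lemma (in tensor_space) tensor2_eq_sym: "u \<approx>\<^sub>2 v \<Longrightarrow> v \<approx>\<^sub>2 u"
  unfolding tensor2_eq_def using free.span_neg[of "u - v"] by simp

lemma (in tensor_space) tensor2_eq_add: "u \<approx>\<^sub>2 v \<Longrightarrow> u' \<approx>\<^sub>2 v' \<Longrightarrow> u + u' \<approx>\<^sub>2 v + v'"
  unfolding tensor2_eq_def using free.span_add[of "u - v" _ "u' - v'"] by (simp add: algebra_simps)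

lemma (in tensor_space) tensor2_eq_scale: "u \<approx>\<^sub>2 v \<Longrightarrow> free_scale c u \<approx>\<^sub>2 free_scale c v"
  unfolding tensor2_eq_def using free.span_scale[of "u - v" _ c]
  by (simp add: free.scale_right_diff_distrib)

lemma (in tensor_space) tensor2_eq_sum:
  "(\<And>i. i \<in> I \<Longrightarrow> u i \<approx>\<^sub>2 v i) \<Longrightarrow> (\<Sum>i\<in>I. u i) \<approx>\<^sub>2 (\<Sum>i\<in>I. v i)"
  by (induction I rule: infinite_finite_induct) (auto intro: tensor2_eq_add tensor2_eq_refl)

lemma (in tensor_space) tensor2_eq_slots:
  assumes "F \<in> slots2"
  shows "basis_vec (F (x + y)) \<approx>\<^sub>2 basis_vec (F x) + basis_vec (F y)"
    and "basis_vec (F (c \<odot> x)) \<approx>\<^sub>2 free_scale c (basis_vec (F x))"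
proof -
  have "basis_vec (F (x + y)) - basis_vec (F x) - basis_vec (F y) \<in> multilinear_relations slots2"
    "basis_vec (F (c \<odot> x)) - free_scale c (basis_vec (F x)) \<in> multilinear_relations slots2"
    using assms unfolding multilinear_relations_def by blast+
  then show "basis_vec (F (x + y)) \<approx>\<^sub>2 basis_vec (F x) + basis_vec (F y)"
    "basis_vec (F (c \<odot> x)) \<approx>\<^sub>2 free_scale c (basis_vec (F x))"
    by (auto simp: tensor2_eq_def diff_diff_eq dest: free.span_base)
qed

lemma (in tensor_space) tensor2_eq_slot_zero:
  assumes "F \<in> slots2"
  shows "basis_vec (F 0) \<approx>\<^sub>2 0"
  using tensor2_eq_slots(2)[OF assms, of 0 0] by simp

lemma (in tensor_space) tensor2_eq_slot_sum:
  assumes "F \<in> slots2"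
  shows "basis_vec (F (\<Sum>i\<in>I. c i \<odot> x i)) \<approx>\<^sub>2 (\<Sum>i\<in>I. free_scale (c i) (basis_vec (F (x i))))"
proof (induction I rule: infinite_finite_induct)
  case (insert i I)
  have "basis_vec (F (c i \<odot> x i + (\<Sum>i\<in>I. c i \<odot> x i))) \<approx>\<^sub>2
      basis_vec (F (c i \<odot> x i)) + basis_vec (F (\<Sum>i\<in>I. c i \<odot> x i))"
    by (rule tensor2_eq_slots(1)[OF assms])
  also have "\<dots> \<approx>\<^sub>2 free_scale (c i) (basis_vec (F (x i))) +
      (\<Sum>i\<in>I. free_scale (c i) (basis_vec (F (x i))))"
    by (intro tensor2_eq_add insert.IH tensor2_eq_slots(2)[OF assms])
  finally show ?case using insert.hyps by simp
qed (use tensor2_eq_slot_zero[OF assms] in auto)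

text \<open>Expand the first factors in the basis, move the scalars across, and collect the second
  factors. For \<open>\<Delta> x\<close> these become the vectors
  \<open>x \<leftharpoonup>\<^sub>c coord b\<close>, so the tensor is recovered from the action of
  functionals.\<close>

lemma (in fd_space) tensor2_eq_coord:
  "u \<approx>\<^sub>2 (\<Sum>b\<in>Basis. basis_vec (b, lin_ext (\<odot>) (\<lambda>(x, y). coord b x \<odot> y) u))"
proof -
  have slots: "(\<lambda>z. (a, z)) \<in> slots2" "(\<lambda>z. (z, a)) \<in> slots2" for a :: 'b
    by (auto simp: slots2_def)
  let ?K = "Poly_Mapping.keys u" and ?c = "Poly_Mapping.lookup u"
  have pure: "basis_vec (x, y) \<approx>\<^sub>2 (\<Sum>b\<in>Basis. basis_vec (b, coord b x \<odot> y))" for x y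
  proof -
    have "basis_vec (\<Sum>b\<in>Basis. coord b x \<odot> b, y) \<approx>\<^sub>2
        (\<Sum>b\<in>Basis. free_scale (coord b x) (basis_vec (b, y)))"
      using tensor2_eq_slot_sum[OF slots(2)] .
    also have "\<dots> \<approx>\<^sub>2 (\<Sum>b\<in>Basis. basis_vec (b, coord b x \<odot> y))"
      by (intro tensor2_eq_sum tensor2_eq_sym[OF tensor2_eq_slots(2)[OF slots(1)]])
    finally show ?thesis by (simp add: sum_coord)
  qed
  have "u = (\<Sum>(x, y)\<in>?K. free_scale (?c (x, y)) (basis_vec (x, y)))"
    by (rule poly_mapping_eqI)
      (simp add: lookup_sum basis_vec_def lookup_single when_def case_prod_unfold in_keys_iff
        if_distrib cong: if_cong)
  also have "\<dots> \<approx>\<^sub>2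
      (\<Sum>(x, y)\<in>?K. free_scale (?c (x, y)) (\<Sum>b\<in>Basis. basis_vec (b, coord b x \<odot> y)))"
    unfolding case_prod_unfold by (intro tensor2_eq_sum tensor2_eq_scale pure)
  also have "\<dots> = (\<Sum>b\<in>Basis. \<Sum>(x, y)\<in>?K. free_scale (?c (x, y)) (basis_vec (b, coord b x \<odot> y)))"
    unfolding case_prod_unfold free.scale_sum_right by (rule sum.swap)
  also have "\<dots> \<approx>\<^sub>2 (\<Sum>b\<in>Basis. basis_vec (b, \<Sum>i\<in>?K. ?c i \<odot> coord b (fst i) \<odot> snd i))"
    by (rule tensor2_eq_sum, rule tensor2_eq_sym, unfold case_prod_unfold prod.collapse)
      (rule tensor2_eq_slot_sum[OF slots(1)])
  finally show ?thesis by (simp add: lin_ext_def case_prod_unfold)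
qed

section \<open>The dual space acting on a coalgebra from both sides\<close>

context coalgebra
begin

definition lcoact :: "('h \<Rightarrow> 'k) \<Rightarrow> 'h \<Rightarrow> 'h"  (infixr \<open>\<rightharpoonup>\<^sub>c\<close> 75)
  where "f \<rightharpoonup>\<^sub>c x = sweedler (\<lambda>a b. f b \<odot> a) x"

lemma linear_sweedler:
  assumes "\<And>a. Vector_Spaces.linear (\<odot>) (\<odot>) (B a)"
    and "\<And>b. Vector_Spaces.linear (\<odot>) (\<odot>) (\<lambda>a. B a b)"
  shows "Vector_Spaces.linear (\<odot>) (\<odot>) (sweedler B)"
proof -
  have "Vector_Spaces.linear free_scale (\<odot>) (lin_ext (\<odot>) (\<lambda>(a, b). B a b))"
    by (rule linear_lin_ext)
  then show ?thesis
    using lin_ext_tensor2_eq[OF comult_add assms] lin_ext_tensor2_eq[OF comult_scale assms]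
    by (simp add: linear_self_iff sweedler_def Vector_Spaces.linear_iff)
qed

lemma linear_coact: "functional f \<Longrightarrow> Vector_Spaces.linear (\<odot>) (\<odot>) (\<lambda>x. x \<leftharpoonup>\<^sub>c f)"
  unfolding coact_def
  by (rule linear_sweedler) (auto simp: linear_self_iff linear_functional_iff algebra_simps)

lemma linear_lcoact: "functional f \<Longrightarrow> Vector_Spaces.linear (\<odot>) (\<odot>) (\<lambda>x. f \<rightharpoonup>\<^sub>c x)"
  unfolding lcoact_def
  by (rule linear_sweedler) (auto simp: linear_self_iff linear_functional_iff algebra_simps)

lemma functional_comp:
  assumes "functional f" "Vector_Spaces.linear (\<odot>) (\<odot>) T"
  shows "functional (\<lambda>x. f (T x))"
  using assms by (simp add: linear_functional_iff linear_self_iff)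

lemma coact_eq_sum:
  "x \<leftharpoonup>\<^sub>c f = (\<Sum>i\<in>Poly_Mapping.keys (\<Delta> x). (Poly_Mapping.lookup (\<Delta> x) i * f (fst i)) \<odot> snd i)"
  by (simp add: coact_def sweedler_def lin_ext_def case_prod_unfold)

lemma lcoact_eq_sum:
  "f \<rightharpoonup>\<^sub>c x = (\<Sum>i\<in>Poly_Mapping.keys (\<Delta> x). (Poly_Mapping.lookup (\<Delta> x) i * f (snd i)) \<odot> fst i)"
  by (simp add: lcoact_def sweedler_def lin_ext_def case_prod_unfold)

lemma coact_sum: "x \<leftharpoonup>\<^sub>c (\<lambda>z. \<Sum>j\<in>J. c j * f j z) = (\<Sum>j\<in>J. c j \<odot> (x \<leftharpoonup>\<^sub>c f j))"
  unfolding coact_eq_sum scale_sum_right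
  by (subst sum.swap) (simp add: sum_distrib_left scale_sum_left mult_ac)

lemma lcoact_sum: "(\<lambda>z. \<Sum>j\<in>J. c j * f j z) \<rightharpoonup>\<^sub>c x = (\<Sum>j\<in>J. c j \<odot> (f j \<rightharpoonup>\<^sub>c x))"
  unfolding lcoact_eq_sum scale_sum_right
  by (subst sum.swap) (simp add: sum_distrib_left scale_sum_left mult_ac)

text \<open>Both sides are \<open>\<Sum> f(x\<^sub>1) g(x\<^sub>2)\<close>: the two actions are
  transposes of each other.\<close>

lemma functional_coact:
  assumes "functional f" "functional g"
  shows "g (x \<leftharpoonup>\<^sub>c f) = f (g \<rightharpoonup>\<^sub>c x)"
  unfolding coact_eq_sum lcoact_eq_sum linear_sum[OF assms(1)] linear_sum[OF assms(2)]
  using assms by (simp add: linear_functional_iff mult_ac)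

lemma coact_counit: "x \<leftharpoonup>\<^sub>c \<epsilon> = x" "\<epsilon> \<rightharpoonup>\<^sub>c x = x"
  unfolding coact_def lcoact_def sweedler_def by (rule counit_left, rule counit_right)

text \<open>This is coassociativity: both sides are
  \<open>\<Sum> f(x\<^sub>1) g(x\<^sub>3) x\<^sub>2\<close>.\<close>

lemma coact_lcoact_commute:
  assumes "functional f" "functional g"
  shows "(g \<rightharpoonup>\<^sub>c x) \<leftharpoonup>\<^sub>c f = g \<rightharpoonup>\<^sub>c (x \<leftharpoonup>\<^sub>c f)"
proof -
  \<comment> \<open>The trilinear map \<open>(a, b, c) \<mapsto> f(a) g(c) b\<close>, to be
    evaluated on the two iterated coproducts.\<close>
  let ?B = "\<lambda>i. (f (fst i) * g (snd (snd i))) \<odot> fst (snd i)"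
  let ?L = "lin_ext (\<odot>) ?B"
  have lin: "Vector_Spaces.linear free_scale (\<odot>) ?L" by (rule linear_lin_ext)
  have "Vector_Spaces.linear (\<odot>) (\<odot>) (\<lambda>x. ?B (F x))" if "F \<in> slots3" for F
    using that assms
    by (auto simp: slots3_def linear_self_iff linear_functional_iff algebra_simps)
  note tri = lin_ext_tensor3_eq[where B = ?B, OF coassoc[of x] this]
  have "?L (lin_ext free_scale (\<lambda>(a, b). lin_ext free_scale (\<lambda>(p, q). basis_vec (p, q, b)) (\<Delta> a)) (\<Delta> x))
      = lin_ext (\<odot>) (\<lambda>(a, b). g b \<odot> (a \<leftharpoonup>\<^sub>c f)) (\<Delta> x)"
    unfolding case_prod_unfold linear_lin_ext_comp[OF lin] lin_ext_basis_vec coact_eq_sum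
    by (simp add: lin_ext_def scale_sum_right mult_ac)
  moreover have "\<dots> = (g \<rightharpoonup>\<^sub>c x) \<leftharpoonup>\<^sub>c f"
    unfolding lcoact_def sweedler_def linear_lin_ext_comp[OF linear_coact[OF assms(1)]]
    using linear_coact[OF assms(1)] by (simp add: case_prod_unfold linear_self_iff)
  moreover have "?L (lin_ext free_scale (\<lambda>(a, b). lin_ext free_scale (\<lambda>(p, q). basis_vec (a, p, q)) (\<Delta> b)) (\<Delta> x))
      = lin_ext (\<odot>) (\<lambda>(a, b). f a \<odot> (g \<rightharpoonup>\<^sub>c b)) (\<Delta> x)"
    unfolding case_prod_unfold linear_lin_ext_comp[OF lin] lin_ext_basis_vec lcoact_eq_sum
    by (simp add: lin_ext_def scale_sum_right mult_ac)
  moreover have "\<dots> = g \<rightharpoonup>\<^sub>c (x \<leftharpoonup>\<^sub>c f)"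
    unfolding coact_def sweedler_def linear_lin_ext_comp[OF linear_lcoact[OF assms(2)]]
    using linear_lcoact[OF assms(2)] by (simp add: case_prod_unfold linear_self_iff)
  ultimately show ?thesis using tri by simp
qed

definition coact_maps :: "('h \<Rightarrow> 'h) set"
  where "coact_maps = {\<lambda>x. x \<leftharpoonup>\<^sub>c f | f. functional f}"

definition lcoact_maps :: "('h \<Rightarrow> 'h) set"
  where "lcoact_maps = {\<lambda>x. f \<rightharpoonup>\<^sub>c x | f. functional f}"

text \<open>A representative of \<open>\<Delta> x\<close> supported in \<open>D \<times> D\<close>
  makes both actions land in \<open>D\<close>, and bilinear maps do not depend on the
  representative.\<close>

lemma subcoalgebra_imp_stable:
  assumes "subcoalgebra D"
  shows "stable (lcoact_maps \<union> coact_maps) D"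
proof -
  have D: "subspace D" using assms by (simp add: subcoalgebra_def)
  have "lin_ext (\<odot>) (\<lambda>(a, b). B a b) (\<Delta> x) \<in> D"
    if x: "x \<in> D" and B: "\<And>a b. a \<in> D \<Longrightarrow> b \<in> D \<Longrightarrow> B a b \<in> D"
      "\<And>a. Vector_Spaces.linear (\<odot>) (\<odot>) (B a)"
      "\<And>b. Vector_Spaces.linear (\<odot>) (\<odot>) (\<lambda>a. B a b)" for x B
  proof -
    obtain u where u: "Poly_Mapping.keys u \<subseteq> D \<times> D" "\<Delta> x \<approx>\<^sub>2 u"
      using assms x by (auto simp: subcoalgebra_def)
    have "lin_ext (\<odot>) (\<lambda>(a, b). B a b) u \<in> D"
      unfolding lin_ext_def by (intro subspace_sum subspace_scale D) (use u(1) B(1) in auto)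
    then show ?thesis using lin_ext_tensor2_eq[OF u(2) B(2,3)] by simp
  qed
  then have "x \<leftharpoonup>\<^sub>c f \<in> D" "f \<rightharpoonup>\<^sub>c x \<in> D" if "x \<in> D" "functional f" for x f
    unfolding coact_def lcoact_def sweedler_def using that D
    by (auto simp: linear_self_iff linear_functional_iff algebra_simps subspace_scale)
  with D show ?thesis
    by (auto simp: stable_def coact_maps_def lcoact_maps_def)
qed

end

section \<open>Subcoalgebras as sub-bimodules, and a coseparability criterion\<close>

locale fd_coalgebra = coalgebra scale \<Delta> \<epsilon> + fd_space scale Basis
  for scale :: "'k::field \<Rightarrow> 'h::ab_group_add \<Rightarrow> 'h" (infixr \<open>\<odot>\<close> 75) and \<Delta> \<epsilon> Basis
begin

text \<open>Paired with a functional \<open>h\<close>, both sides become \<open>g ((h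
  \<rightharpoonup>\<^sub>c x) \<leftharpoonup>\<^sub>c f)\<close> because the two actions commute.
  The functional on the right is the convolution product of \<open>f\<close> and
  \<open>g\<close>.\<close>

lemma coact_coact:
  assumes "functional f" "functional g"
  shows "(x \<leftharpoonup>\<^sub>c f) \<leftharpoonup>\<^sub>c g = x \<leftharpoonup>\<^sub>c (\<lambda>z. g (z \<leftharpoonup>\<^sub>c f))"
proof (rule functionals_separate)
  fix h assume h: "functional h"
  have "functional (\<lambda>z. g (z \<leftharpoonup>\<^sub>c f))"
    by (rule functional_comp[OF assms(2) linear_coact[OF assms(1)]])
  then show "h ((x \<leftharpoonup>\<^sub>c f) \<leftharpoonup>\<^sub>c g) = h (x \<leftharpoonup>\<^sub>c (\<lambda>z. g (z \<leftharpoonup>\<^sub>c f)))"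
    using assms h by (simp add: functional_coact[of _ h] coact_lcoact_commute)
qed

lemma lcoact_lcoact:
  assumes "functional f" "functional g"
  shows "g \<rightharpoonup>\<^sub>c (f \<rightharpoonup>\<^sub>c x) = (\<lambda>z. g (f \<rightharpoonup>\<^sub>c z)) \<rightharpoonup>\<^sub>c x"
proof (rule functionals_separate)
  fix h assume h: "functional h"
  have "functional (\<lambda>z. g (f \<rightharpoonup>\<^sub>c z))"
    by (rule functional_comp[OF assms(2) linear_lcoact[OF assms(1)]])
  then show "h (g \<rightharpoonup>\<^sub>c (f \<rightharpoonup>\<^sub>c x)) = h ((\<lambda>z. g (f \<rightharpoonup>\<^sub>c z)) \<rightharpoonup>\<^sub>c x)"
    using assms h by (simp add: functional_coact[of h, symmetric] coact_lcoact_commute)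
qed

text \<open>Extend a basis \<open>C0\<close> of \<open>V\<close> to a basis \<open>C\<close> of the
  whole space and expand the first factors of \<open>\<Delta> x\<close> in \<open>C\<close>. The
  second factors lie in \<open>V\<close> by stability, and the terms with first factor outside
  \<open>C0\<close> vanish.\<close>

lemma stable_imp_subcoalgebra:
  assumes "stable (lcoact_maps \<union> coact_maps) V"
  shows "subcoalgebra V"
proof -
  have V: "subspace V" and coact: "\<And>f x. functional f \<Longrightarrow> x \<in> V \<Longrightarrow> x \<leftharpoonup>\<^sub>c f \<in> V"
    and lcoact: "\<And>f x. functional f \<Longrightarrow> x \<in> V \<Longrightarrow> f \<rightharpoonup>\<^sub>c x \<in> V"
    using assms by (auto simp: stable_def coact_maps_def lcoact_maps_def)
  obtain C0 where C0: "C0 \<subseteq> V" "independent C0" "V \<subseteq> span C0"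
    using maximal_independent_subset by blast
  obtain C where C: "C0 \<subseteq> C" "independent C" "UNIV \<subseteq> span C"
    using maximal_independent_subset_extend[OF subset_UNIV C0(2)] .
  interpret C: fd_space "(\<odot>)" C
    by unfold_locales (use C finiteI_independent[of C] in auto)
  have coord0: "C.coord c v = 0" if "v \<in> V" "c \<notin> C0" for c v
  proof -
    have "v \<in> span C0" using that C0(3) by blast
    then show ?thesis
      using representation_extend[OF C(2) _ C(1)] representation_ne_zero[of C0 v c] that
      by (auto simp: C.coord_def)
  qed
  have "\<exists>u. Poly_Mapping.keys u \<subseteq> V \<times> V \<and> \<Delta> x \<approx>\<^sub>2 u" if x: "x \<in> V" for x
  proof (intro exI conjI)
    have fin: "finite C" by (rule C.finite_Basis)
    let ?e = "\<lambda>c. basis_vec (c, x \<leftharpoonup>\<^sub>c C.coord c) :: 'h \<times> 'h \<Rightarrow>\<^sub>0 'k"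
    let ?u = "\<lambda>D. \<Sum>c\<in>D. ?e c"
    \<comment> \<open>Transposition turns \<open>f (x \<leftharpoonup>\<^sub>c C.coord c)\<close>
      into the coordinate at \<open>c\<close> of \<open>f \<rightharpoonup>\<^sub>c x\<close>, a
      vector of \<open>V\<close>.\<close>
    have "x \<leftharpoonup>\<^sub>c C.coord c = 0" if c: "c \<notin> C0" for c
    proof (rule C.functionals_separate)
      fix f assume "functional f"
      then show "f (x \<leftharpoonup>\<^sub>c C.coord c) = f 0"
        by (simp add: functional_coact C.linear_coord coord0 lcoact x c linear_zero)
    qed
    then have "basis_vec (c, x \<leftharpoonup>\<^sub>c C.coord c) \<approx>\<^sub>2 0" if "c \<in> C - C0" for c
      using tensor2_eq_slot_zero[of "\<lambda>z. (c, z)"] that by (auto simp: slots2_def)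
    then have null: "?u (C - C0) \<approx>\<^sub>2 (\<Sum>c\<in>C - C0. 0)"
      by (rule tensor2_eq_sum)
    have "\<Delta> x \<approx>\<^sub>2 ?u C"
      using C.tensor2_eq_coord[of "\<Delta> x"] by (simp add: coact_def sweedler_def)
    also have "?u C = ?u C0 + ?u (C - C0)"
      using sum.subset_diff[OF C(1) fin] by (simp add: add.commute)
    also have "\<dots> \<approx>\<^sub>2 ?u C0 + (\<Sum>c\<in>C - C0. 0)"
      by (rule tensor2_eq_add[OF tensor2_eq_refl null])
    finally show "\<Delta> x \<approx>\<^sub>2 ?u C0" by simp
    have "Poly_Mapping.keys (?u C0) \<subseteq> (\<Union>c\<in>C0. Poly_Mapping.keys (?e c))"
      by (rule Poly_Mapping.keys_sum)
    also have "\<dots> \<subseteq> V \<times> V"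
      using C0(1) coact[OF C.linear_coord x] by (auto simp: basis_vec_def)
    finally show "Poly_Mapping.keys (?u C0) \<subseteq> V \<times> V" .
  qed
  with V show ?thesis by (simp add: subcoalgebra_def)
qed

lemma stable_iff_subcoalgebra: "stable (lcoact_maps \<union> coact_maps) V \<longleftrightarrow> subcoalgebra V"
  using stable_imp_subcoalgebra subcoalgebra_imp_stable by blast

text \<open>The sum of \<open>\<sigma> b \<otimes> coord b\<close> over the basis is a separability
  element of the dual algebra. Subcoalgebras are sub-bimodules over that algebra, so a linear
  projection is averaged first over the right action and then over the left one.\<close>

lemma coseparable_imp_cosemisimple:
  fixes \<sigma> :: "'h \<Rightarrow> 'h \<Rightarrow> 'k"
  assumes \<sigma>: "\<And>x. functional (\<sigma> x)" "\<And>y. functional (\<lambda>x. \<sigma> x y)"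
    and casimir: "\<And>x y. x \<leftharpoonup>\<^sub>c (\<lambda>z. \<sigma> z y) = \<sigma> x \<rightharpoonup>\<^sub>c y"
    and norm: "\<And>x. lin_ext (*) (\<lambda>(a, b). \<sigma> b a) (\<Delta> x) = \<epsilon> x"
  shows cosemisimple
proof -
  \<comment> \<open>\<open>f\<close> is applied to the Casimir identity: its action moves from one
    argument of \<open>\<sigma>\<close> to the other.\<close>
  have shift: "f (\<sigma> x \<rightharpoonup>\<^sub>c y) = \<sigma> (f \<rightharpoonup>\<^sub>c x) y" if "functional f" for f x y
    by (simp add: functional_coact[OF \<sigma>(2) that] flip: casimir)
  have \<sigma>_expand: "\<sigma> x y = (\<Sum>b\<in>Basis. coord b x * \<sigma> b y)" for x y
    using sum_coord_functional[OF \<sigma>(2)] by simp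
  have coord_lcoact: "coord i (f \<rightharpoonup>\<^sub>c z) = (\<Sum>j\<in>Basis. coord i (f \<rightharpoonup>\<^sub>c j) * coord j z)"
    if "functional f" for f i z
    using sum_coord_functional[OF functional_comp[OF linear_coord linear_lcoact[OF that]], of z i]
    by (simp add: mult.commute)
  \<comment> \<open>The products of \<open>\<sigma> b\<close> and \<open>coord b\<close> in the dual
    algebra add up to its unit \<open>\<epsilon>\<close>; this is \<open>norm\<close> once
    \<open>\<sigma>\<close> is expanded in coordinates.\<close>
  have counit: "(\<Sum>b\<in>Basis. coord b (z \<leftharpoonup>\<^sub>c \<sigma> b)) = \<epsilon> z" for z
  proof -
    have "coord b (z \<leftharpoonup>\<^sub>c \<sigma> b) = lin_ext (*) (\<lambda>(x, y). coord b y * \<sigma> b x) (\<Delta> z)" for b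
      unfolding coact_def sweedler_def linear_lin_ext_comp[OF linear_coord] case_prod_unfold
      using linear_coord by (simp add: linear_functional_iff mult_ac)
    then have "(\<Sum>b\<in>Basis. coord b (z \<leftharpoonup>\<^sub>c \<sigma> b)) = 
        lin_ext (*) (\<lambda>(x, y). \<Sum>b\<in>Basis. coord b y * \<sigma> b x) (\<Delta> z)"
      unfolding lin_ext_def case_prod_unfold sum_distrib_left
      by (subst sum.swap) simp
    then show ?thesis by (simp add: norm flip: \<sigma>_expand)
  qed
  have one: "(\<Sum>b\<in>Basis. (x \<leftharpoonup>\<^sub>c \<sigma> b) \<leftharpoonup>\<^sub>c coord b) = x" for x
    using coact_sum[of x "\<lambda>_. 1" "\<lambda>b z. coord b (z \<leftharpoonup>\<^sub>c \<sigma> b)" Basis]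
    by (simp add: coact_coact \<sigma> linear_coord counit coact_counit)
  have lone: "(\<Sum>b\<in>Basis. \<sigma> b \<rightharpoonup>\<^sub>c (coord b \<rightharpoonup>\<^sub>c x)) = x" for x
  proof -
    have "\<sigma> b (coord b \<rightharpoonup>\<^sub>c z) = coord b (z \<leftharpoonup>\<^sub>c \<sigma> b)" for b z
      by (simp add: functional_coact \<sigma> linear_coord)
    then show ?thesis
      using lcoact_sum[of "\<lambda>_. 1" "\<lambda>b z. coord b (z \<leftharpoonup>\<^sub>c \<sigma> b)" Basis x]
      by (simp add: lcoact_lcoact \<sigma> linear_coord counit coact_counit)
  qed
  have lin: "Vector_Spaces.linear (\<odot>) (\<odot>) T" if "T \<in> lcoact_maps \<union> coact_maps" for T
    using that linear_coact linear_lcoact by (auto simp: coact_maps_def lcoact_maps_def)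
  have "\<exists>p. equivariant_projection (lcoact_maps \<union> coact_maps) V p"
    if V: "stable (lcoact_maps \<union> coact_maps) V" for V
  proof -
    have sub: "subspace V" and st: "\<And>f x. functional f \<Longrightarrow> x \<in> V \<Longrightarrow> x \<leftharpoonup>\<^sub>c f \<in> V"
      "\<And>f x. functional f \<Longrightarrow> x \<in> V \<Longrightarrow> f \<rightharpoonup>\<^sub>c x \<in> V"
      using V by (auto simp: stable_def coact_maps_def lcoact_maps_def)
    obtain p0 where p0: "equivariant_projection {} V p0"
      using exists_projection[OF sub] .
    define p1 where "p1 = (\<lambda>x. \<Sum>b\<in>Basis. p0 (x \<leftharpoonup>\<^sub>c \<sigma> b) \<leftharpoonup>\<^sub>c coord b)"
    have "equivariant_projection (coact_maps \<union> {}) V p1"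
      unfolding p1_def
    proof (rule average_projection[OF p0 sub])
      fix T assume "T \<in> coact_maps"
      then obtain f where f: "functional f" and T: "T = (\<lambda>x. x \<leftharpoonup>\<^sub>c f)"
        by (auto simp: coact_maps_def)
      \<comment> \<open>The matrix of the left action of \<open>f\<close> in \<open>Basis\<close>
        serves both families: for \<open>coord\<close> by expansion, for \<open>\<sigma>\<close> by
        \<open>shift\<close>.\<close>
      show "\<exists>m. \<forall>i\<in>Basis. \<forall>x. T (x \<leftharpoonup>\<^sub>c coord i) = (\<Sum>j\<in>Basis. m j i \<odot> (x \<leftharpoonup>\<^sub>c coord j)) \<and>
          T x \<leftharpoonup>\<^sub>c \<sigma> i = (\<Sum>j\<in>Basis. m i j \<odot> (x \<leftharpoonup>\<^sub>c \<sigma> j))"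
      proof (intro exI ballI allI conjI)
        fix i x
        have "(\<lambda>z. f (z \<leftharpoonup>\<^sub>c coord i)) = (\<lambda>z. \<Sum>j\<in>Basis. coord i (f \<rightharpoonup>\<^sub>c j) * coord j z)"
          unfolding functional_coact[OF linear_coord f] by (rule ext) (rule coord_lcoact[OF f])
        then show "T (x \<leftharpoonup>\<^sub>c coord i) = (\<Sum>j\<in>Basis. coord i (f \<rightharpoonup>\<^sub>c j) \<odot> (x \<leftharpoonup>\<^sub>c coord j))"
          by (simp only: T coact_coact[OF linear_coord f] coact_sum)
        have "(\<lambda>z. \<sigma> i (z \<leftharpoonup>\<^sub>c f)) = (\<lambda>z. \<Sum>j\<in>Basis. coord j (f \<rightharpoonup>\<^sub>c i) * \<sigma> j z)"
          unfolding functional_coact[OF f \<sigma>(1)] shift[OF f] by (rule ext) (rule \<sigma>_expand)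
        then show "T x \<leftharpoonup>\<^sub>c \<sigma> i = (\<Sum>j\<in>Basis. coord j (f \<rightharpoonup>\<^sub>c i) \<odot> (x \<leftharpoonup>\<^sub>c \<sigma> j))"
          by (simp only: T coact_coact[OF f \<sigma>(1)] coact_sum)
      qed
    qed (auto intro: linear_coact \<sigma> linear_coord lin st one)
    then have p1: "equivariant_projection coact_maps V p1" by simp
    \<comment> \<open>The families trade places: a left action applies the right factor of a product
      first, and the product is still that of \<open>\<sigma> b\<close> and \<open>coord b\<close>.
      Equivariance of \<open>p1\<close> for the right action survives because the actions
      commute.\<close>
    have "equivariant_projection (lcoact_maps \<union> coact_maps) V
        (\<lambda>x. \<Sum>b\<in>Basis. \<sigma> b \<rightharpoonup>\<^sub>c p1 (coord b \<rightharpoonup>\<^sub>c x))"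
    proof (rule average_projection[OF p1 sub])
      fix T assume "T \<in> lcoact_maps"
      then obtain f where f: "functional f" and T: "T = (\<lambda>x. f \<rightharpoonup>\<^sub>c x)"
        by (auto simp: lcoact_maps_def)
      show "\<exists>m. \<forall>i\<in>Basis. \<forall>x. T (\<sigma> i \<rightharpoonup>\<^sub>c x) = (\<Sum>j\<in>Basis. m j i \<odot> (\<sigma> j \<rightharpoonup>\<^sub>c x)) \<and>
          coord i \<rightharpoonup>\<^sub>c T x = (\<Sum>j\<in>Basis. m i j \<odot> (coord j \<rightharpoonup>\<^sub>c x))"
      proof (intro exI ballI allI conjI)
        fix i x
        have "(\<lambda>z. f (\<sigma> i \<rightharpoonup>\<^sub>c z)) = (\<lambda>z. \<Sum>j\<in>Basis. coord j (f \<rightharpoonup>\<^sub>c i) * \<sigma> j z)"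
          unfolding shift[OF f] by (rule ext) (rule \<sigma>_expand)
        then show "T (\<sigma> i \<rightharpoonup>\<^sub>c x) = (\<Sum>j\<in>Basis. coord j (f \<rightharpoonup>\<^sub>c i) \<odot> (\<sigma> j \<rightharpoonup>\<^sub>c x))"
          by (simp only: T lcoact_lcoact[OF \<sigma>(1) f] lcoact_sum)
        have "(\<lambda>z. coord i (f \<rightharpoonup>\<^sub>c z)) = (\<lambda>z. \<Sum>j\<in>Basis. coord i (f \<rightharpoonup>\<^sub>c j) * coord j z)"
          by (rule ext) (rule coord_lcoact[OF f])
        then show "coord i \<rightharpoonup>\<^sub>c T x = (\<Sum>j\<in>Basis. coord i (f \<rightharpoonup>\<^sub>c j) \<odot> (coord j \<rightharpoonup>\<^sub>c x))"
          by (simp only: T lcoact_lcoact[OF f linear_coord] lcoact_sum)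
      qed
    qed (auto intro: linear_lcoact \<sigma> linear_coord lin st lone
        simp: coact_maps_def coact_lcoact_commute linear_coord \<sigma>)
    then show ?thesis by blast
  qed
  from span_simple_stable[OF lin this] show ?thesis
    by (simp add: cosemisimple_def simple_stable_def simple_subcoalgebra_def stable_iff_subcoalgebra)
qed

end

section \<open>BiFrobenius algebras\<close>

context k_algebra
begin

lemma linear_mult: "Vector_Spaces.linear (\<odot>) (\<odot>) (\<lambda>x. a * x)" "Vector_Spaces.linear (\<odot>) (\<odot>) (\<lambda>x. x * a)"
  by (auto simp: linear_self_iff algebra_simps mult_scale_left mult_scale_right)

lemma stable_iff_left_ideal: "stable (range (*)) V \<longleftrightarrow> left_ideal V"
  by (auto simp: stable_def left_ideal_def)

lemma simple_stable_iff_left_ideal: "simple_stable (range (*)) V \<longleftrightarrow> simple_left_ideal V"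
  by (simp add: simple_stable_def simple_left_ideal_def stable_iff_left_ideal)

end

section \<open>The Frobenius form, its dual bases and the element \<open>t\<close>\<close>

context bifrobenius_algebra
begin

abbreviation S :: "'h \<Rightarrow> 'h"
  where "S \<equiv> antipode t \<phi>"

definition Sinv :: "'h \<Rightarrow> 'h"
  where "Sinv = inv S"

lemma functional_phi: "functional \<phi>"
  using linear_phi by simp

lemmas functional_phi_mult = functional_comp[OF functional_phi linear_mult(1)]
  functional_comp[OF functional_phi linear_mult(2)]

lemma phi_simps:
  "\<phi> (x + y) = \<phi> x + \<phi> y" "\<phi> (x - y) = \<phi> x - \<phi> y" "\<phi> (c \<odot> x) = c * \<phi> x" "\<phi> 0 = 0"
  "\<phi> (\<Sum>i\<in>A. f i) = (\<Sum>i\<in>A. \<phi> (f i))"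
  using functional_phi linear_diff[OF functional_phi] linear_zero[OF functional_phi]
    linear_sum[OF functional_phi] by (auto simp: linear_functional_iff)

lemma antipode_eq_coact: "S x = t \<leftharpoonup>\<^sub>c (\<lambda>a. \<phi> (a * x))"
  by (simp add: antipode_def coact_def)

lemma linear_S: "Vector_Spaces.linear (\<odot>) (\<odot>) S"
  and S_mult: "S (x * y) = S y * S x"
  and S_one: "S 1 = 1"
  and bij_S: "bij S"
  using antipode_algebra by (auto simp: algebra_antiautomorphism_def)

lemma S_Sinv [simp]: "S (Sinv x) = x" and Sinv_S [simp]: "Sinv (S x) = x"
  using bij_S by (simp_all add: Sinv_def bij_is_surj surj_f_inv_f bij_is_inj)

lemma linear_Sinv: "Vector_Spaces.linear (\<odot>) (\<odot>) Sinv"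
proof -
  have "Sinv (x + y) = Sinv x + Sinv y" "Sinv (c \<odot> x) = c \<odot> Sinv x" for x y c
    using linear_S Sinv_S[of "Sinv x + Sinv y"] Sinv_S[of "c \<odot> Sinv x"] by (simp_all add: linear_self_iff)
  then show ?thesis by (simp add: linear_self_iff)
qed

lemma Sinv_mult: "Sinv (x * y) = Sinv y * Sinv x"
  using Sinv_S[of "Sinv y * Sinv x"] by (simp add: S_mult)

lemma Sinv_one: "Sinv 1 = 1"
  using Sinv_S[of 1] by (simp add: S_one)

text \<open>\<open>dual_left\<close> and \<open>dual_right\<close> are the tensor factors of \<open>\<Sum> t\<^sub>1 \<otimes> S\<^sup>-\<^sup>1 t\<^sub>2\<close>, the pair of dual bases
  of the Frobenius form \<open>\<phi>\<close>.\<close>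

definition dual_index :: "('h \<times> 'h) set"
  where "dual_index = Poly_Mapping.keys (\<Delta> t)"

definition dual_left :: "'h \<times> 'h \<Rightarrow> 'h"
  where "dual_left i = fst i"

definition dual_right :: "'h \<times> 'h \<Rightarrow> 'h"
  where "dual_right i = Poly_Mapping.lookup (\<Delta> t) i \<odot> Sinv (snd i)"

lemma sum_dual:
  assumes "\<And>a. Vector_Spaces.linear (\<odot>) (\<odot>) (B a)"
  shows "(\<Sum>i\<in>dual_index. B (dual_left i) (dual_right i)) = sweedler (\<lambda>a b. B a (Sinv b)) t"
  using assms
  by (simp add: dual_index_def dual_left_def dual_right_def sweedler_def lin_ext_def case_prod_unfold
      linear_self_iff)

lemma dual_bases: "(\<Sum>i\<in>dual_index. \<phi> (dual_left i * x) \<odot> dual_right i) = x"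
proof -
  have "(\<Sum>i\<in>dual_index. \<phi> (dual_left i * x) \<odot> dual_right i) = Sinv (S x)"
    unfolding antipode_eq_coact coact_eq_sum linear_sum[OF linear_Sinv]
    using linear_Sinv
    by (simp add: dual_index_def dual_left_def dual_right_def linear_self_iff mult.commute)
  then show ?thesis by simp
qed

text \<open>By \<open>dual_bases\<close> the finitely many vectors \<open>dual_right i\<close> span
  the space, so a basis can be chosen among them.\<close>

lemma exists_basis:
  obtains Basis where "fd_coalgebra (\<odot>) \<Delta> \<epsilon> Basis"
proof -
  let ?G = "dual_right ` dual_index"
  obtain B where B: "B \<subseteq> ?G" "independent B" "?G \<subseteq> span B"
    using maximal_independent_subset .
  have "x \<in> span B" for x
    by (subst dual_bases[symmetric]) (use B(3) in \<open>auto intro!: span_sum span_scale\<close>)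
  moreover have "finite B"
    using B(1) by (rule finite_subset) (simp add: dual_index_def)
  ultimately have "fd_coalgebra (\<odot>) \<Delta> \<epsilon> B"
    using B(2) by unfold_locales auto
  then show thesis by (rule that)
qed

text \<open>The Frobenius condition gives surjectivity of
  \<open>z \<mapsto> \<phi> \<leftharpoonup>\<^sub>a z\<close> onto the dual space; finite dimension
  turns it into injectivity.\<close>

lemma phi_nondegenerate:
  assumes "\<And>y. \<phi> (z * y) = 0"
  shows "z = 0"
proof -
  obtain Basis where "fd_coalgebra (\<odot>) \<Delta> \<epsilon> Basis" by (rule exists_basis)
  then interpret fd_coalgebra "(\<odot>)" \<Delta> \<epsilon> Basis .
  have "\<exists>w. coord b = (\<lambda>y. \<phi> (w * y))" for b
  proof -
    have "coord b \<in> range (\<lambda>x. \<phi> \<leftharpoonup>\<^sub>a x)"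
      using linear_coord[of b] unfolding frobenius[symmetric] by simp
    then show ?thesis by (auto simp: act_def)
  qed
  then obtain w where w: "\<And>b. coord b = (\<lambda>y. \<phi> (w b * y))" by metis
  \<comment> \<open>\<open>M\<close> sends a basis vector \<open>b\<close> to the \<open>w b\<close>
    representing \<open>coord b\<close>. It is an endomorphism, so its injectivity yields
    surjectivity.\<close>
  define M where "M z = (\<Sum>b\<in>Basis. coord b z \<odot> w b)" for z
  have phi_M: "\<phi> (M z * y) = coord y z" if "y \<in> Basis" for z y
  proof -
    have "\<phi> (M z * y) = (\<Sum>b\<in>Basis. coord b z * coord b y)"
      by (subst (2) w) (simp add: M_def sum_distrib_right mult_scale_left phi_simps)
    then show ?thesis
      using that by (simp add: coord_Basis if_distrib finite_Basis cong: if_cong)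
  qed
  have coord_inj: "x = y" if "\<And>b. b \<in> Basis \<Longrightarrow> coord b x = coord b y" for x y
  proof -
    have "(\<Sum>b\<in>Basis. coord b x \<odot> b) = (\<Sum>b\<in>Basis. coord b y \<odot> b)"
      by (rule sum.cong) (simp_all add: that)
    then show ?thesis by (simp only: sum_coord)
  qed
  have lin: "coord b (x + y) = coord b x + coord b y" "coord b (c \<odot> x) = c * coord b x" for b c x y
    using linear_coord[of b] by (auto simp: linear_functional_iff)
  have "Vector_Spaces.linear (\<odot>) (\<odot>) M"
    by (simp add: linear_self_iff M_def lin scale_left_distrib sum.distrib scale_sum_right)
  moreover have "inj M"
    by (rule injI, rule coord_inj) (metis phi_M)
  ultimately have "surj M" by (rule linear_inj_imp_surj)
  then obtain u where u: "z = M u" by (rule surjE)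
  have "u = 0"
    by (rule coord_inj) (use assms u linear_zero[OF linear_coord] in \<open>simp flip: phi_M\<close>)
  then show ?thesis by (simp add: u M_def linear_zero[OF linear_coord])
qed

text \<open>Expanding \<open>y\<close> in \<open>\<phi> (x * y)\<close> by \<open>dual_bases\<close>
  shows that both sides pair equally with every \<open>y\<close>; nondegeneracy concludes.\<close>

lemma dual_bases': "(\<Sum>i\<in>dual_index. \<phi> (x * dual_right i) \<odot> dual_left i) = x"
proof -
  have "\<phi> (((\<Sum>i\<in>dual_index. \<phi> (x * dual_right i) \<odot> dual_left i) - x) * y) = 0" for y
  proof -
    have "\<phi> (x * y) = \<phi> (x * (\<Sum>i\<in>dual_index. \<phi> (dual_left i * y) \<odot> dual_right i))"
      by (simp add: dual_bases)
    then show ?thesis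
      by (simp add: left_diff_distrib phi_simps sum_distrib_left sum_distrib_right mult_scale_left
          mult_scale_right mult.commute)
  qed
  from phi_nondegenerate[OF this] show ?thesis by simp
qed

text \<open>Multiplication by \<open>y\<close> acts on the two dual families by the same matrix
  \<open>?c\<close>, read along rows for one and along columns for the other.\<close>

lemma casimir:
  assumes "\<And>a. Vector_Spaces.linear (\<odot>) (\<odot>) (B a)"
    and "\<And>b. Vector_Spaces.linear (\<odot>) (\<odot>) (\<lambda>a. B a b)"
  shows "(\<Sum>i\<in>dual_index. B (dual_left i * y) (dual_right i)) =
    (\<Sum>i\<in>dual_index. B (dual_left i) (y * dual_right i))"
proof -
  let ?c = "\<lambda>j i. \<phi> (dual_left j * y * dual_right i)"
  have B: "B a (\<Sum>j\<in>J. c j \<odot> f j) = (\<Sum>j\<in>J. c j \<odot> B a (f j))"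
    "B (\<Sum>j\<in>J. c j \<odot> f j) b = (\<Sum>j\<in>J. c j \<odot> B (f j) b)"
    for a b c and f :: "'h \<times> 'h \<Rightarrow> 'h" and J
    unfolding linear_sum[OF assms(1)] linear_sum[OF assms(2)]
    using assms by (simp_all add: linear_self_iff)
  have "(\<Sum>i\<in>dual_index. B (dual_left i) (y * dual_right i)) =
      (\<Sum>i\<in>dual_index. B (dual_left i) (\<Sum>j\<in>dual_index. ?c j i \<odot> dual_right j))"
    by (simp add: mult.assoc dual_bases)
  also have "\<dots> = (\<Sum>j\<in>dual_index. B (\<Sum>i\<in>dual_index. ?c j i \<odot> dual_left i) (dual_right j))"
    unfolding B by (rule sum.swap)
  finally show ?thesis by (simp add: dual_bases')
qed

lemma phi_t: "\<phi> (t * x) = \<epsilon> x"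
  using act_t by (metis act_def)

lemma t_nonzero: "t \<noteq> 0"
  using phi_t[of 1] by (auto simp: one_grouplike phi_simps)

lemma t_mult: "t * x = \<epsilon> x \<odot> t"
proof -
  have "\<phi> ((t * x - \<epsilon> x \<odot> t) * y) = 0" for y
    by (simp add: left_diff_distrib mult_scale_left phi_simps phi_t counit_mult mult.assoc)
  from phi_nondegenerate[OF this] show ?thesis by simp
qed

text \<open>Expanding \<open>dual_right i\<close> in the basis and summing over \<open>i\<close>
  first, \<open>dual_bases\<close> leaves the sum of the coordinates \<open>coord b b\<close>, the
  trace of the identity.\<close>

lemma trace_id:
  assumes "fd_coalgebra (\<odot>) \<Delta> \<epsilon> Basis"
  shows "(\<Sum>i\<in>dual_index. \<phi> (dual_left i * dual_right i)) = of_nat (card Basis)"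
proof -
  interpret fd_coalgebra "(\<odot>)" \<Delta> \<epsilon> Basis by fact
  have "(\<Sum>i\<in>dual_index. \<phi> (dual_left i * dual_right i)) =
      (\<Sum>i\<in>dual_index. \<Sum>b\<in>Basis. coord b (dual_right i) * \<phi> (dual_left i * b))"
    using sum_coord_functional[OF functional_phi_mult(1)] by simp
  also have "\<dots> = (\<Sum>b\<in>Basis. coord b (\<Sum>i\<in>dual_index. \<phi> (dual_left i * b) \<odot> dual_right i))"
    using linear_coord
    by (subst sum.swap) (simp add: linear_sum[OF linear_coord] linear_functional_iff mult.commute)
  also have "\<dots> = of_nat (card Basis)"
    by (simp add: dual_bases coord_Basis)
  finally show ?thesis .
qed

text \<open>Some simple left ideal \<open>I\<close> is not in the kernel of
  \<open>\<epsilon>\<close>, since the kernel misses \<open>1\<close>; by simplicity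
  \<open>I\<close> meets the kernel only in \<open>0\<close>. Were \<open>\<epsilon> t = 0\<close>,
  that intersection would contain \<open>t * u\<close> for \<open>u\<close> in \<open>I\<close>, but
  this is \<open>\<epsilon> u \<odot> t\<close>, nonzero for suitable \<open>u\<close>.\<close>

lemma semisimple_imp_counit_t:
  assumes semisimple
  shows "\<epsilon> t \<noteq> 0"
proof
  assume "\<epsilon> t = 0"
  have eps: "\<epsilon> (x + y) = \<epsilon> x + \<epsilon> y" "\<epsilon> (c \<odot> x) = c * \<epsilon> x" "\<epsilon> 0 = 0" "\<epsilon> (x - y) = \<epsilon> x - \<epsilon> y" for x y c
    using linear_counit linear_zero[OF linear_counit] linear_diff[OF linear_counit]
    by (auto simp: linear_functional_iff)
  have ker: "subspace {x. \<epsilon> x = 0}"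
    by (simp add: subspace_def eps)
  have "\<not> \<Union>{I. simple_left_ideal I} \<subseteq> {x. \<epsilon> x = 0}"
  proof
    assume "\<Union>{I. simple_left_ideal I} \<subseteq> {x. \<epsilon> x = 0}"
    then have "span (\<Union>{I. simple_left_ideal I}) \<subseteq> {x. \<epsilon> x = 0}"
      using ker by (rule span_minimal)
    then have "\<epsilon> 1 = 0"
      using assms unfolding semisimple_def by blast
    then show False by (simp add: one_grouplike)
  qed
  then obtain I u where I: "simple_left_ideal I" and u: "u \<in> I" "\<epsilon> u \<noteq> 0" by blast
  have li: "left_ideal I" using I by (simp add: simple_left_ideal_def)
  define J where "J = I \<inter> {x. \<epsilon> x = 0}"
  have "left_ideal J"
    using li ker by (auto simp: J_def left_ideal_def subspace_inter counit_mult)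
  moreover have "J \<subseteq> I" "J \<noteq> I"
    using u by (auto simp: J_def)
  ultimately have J: "J = {0}"
    using I by (auto simp: simple_left_ideal_def)
  have "t * u \<in> J"
    using li u \<open>\<epsilon> t = 0\<close> by (auto simp: J_def left_ideal_def counit_mult)
  then have "\<epsilon> u \<odot> t = 0"
    using J by (simp add: t_mult)
  then show False
    using u t_nonzero by simp
qed

text \<open>By \<open>dual_bases'\<close>, \<open>x = g \<rightharpoonup>\<^sub>c t\<close> for the
  functional \<open>g\<close> on the right. Commuting the actions leaves \<open>\<phi>\<close>
  acting on \<open>t\<close>, which yields \<open>S (Sinv y) = y\<close>.\<close>

lemma coact_phi_Sinv: "x \<leftharpoonup>\<^sub>c (\<lambda>z. \<phi> (z * Sinv y)) = (\<lambda>z. \<phi> (x * Sinv z)) \<rightharpoonup>\<^sub>c y"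
proof -
  obtain Basis where "fd_coalgebra (\<odot>) \<Delta> \<epsilon> Basis" by (rule exists_basis)
  then interpret fd_coalgebra "(\<odot>)" \<Delta> \<epsilon> Basis .
  define g where "g = (\<lambda>z. \<phi> (x * Sinv z))"
  have g: "functional g"
    unfolding g_def by (rule functional_comp[OF functional_phi_mult(1) linear_Sinv])
  have "g \<rightharpoonup>\<^sub>c t = (\<Sum>i\<in>dual_index. \<phi> (x * dual_right i) \<odot> dual_left i)"
    using linear_Sinv
    by (simp add: lcoact_eq_sum g_def dual_index_def dual_left_def dual_right_def mult_scale_right
        phi_simps)
  then have x: "g \<rightharpoonup>\<^sub>c t = x" by (simp add: dual_bases')
  have "(g \<rightharpoonup>\<^sub>c t) \<leftharpoonup>\<^sub>c (\<lambda>z. \<phi> (z * Sinv y)) = g \<rightharpoonup>\<^sub>c (t \<leftharpoonup>\<^sub>c (\<lambda>z. \<phi> (z * Sinv y)))"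
    by (rule coact_lcoact_commute[OF functional_phi_mult(2) g])
  also have "\<dots> = g \<rightharpoonup>\<^sub>c y"
    by (simp flip: antipode_eq_coact)
  finally show ?thesis unfolding x by (simp only: g_def)
qed

end

section \<open>Type \<open>S\<close>: Maschke criteria and the square of the antipode\<close>

context sbf_algebra
begin

text \<open>\<open>Sinv\<close> reverses products, so it carries the identity
  \<open>\<Sum> S(t\<^sub>1) t\<^sub>2 = \<epsilon>(t)1\<close> to this one.\<close>

lemma sum_dual_right_left: "(\<Sum>i\<in>dual_index. dual_right i * dual_left i) = \<epsilon> t \<odot> 1"
proof -
  have "(\<Sum>i\<in>dual_index. dual_right i * dual_left i) = sweedler (\<lambda>a b. Sinv b * a) t"
    by (rule sum_dual) (rule linear_mult)
  also have "\<dots> = Sinv (sweedler (\<lambda>a b. S a * b) t)"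
    by (simp add: sweedler_def linear_lin_ext_comp[OF linear_Sinv] case_prod_unfold Sinv_mult)
  also have "\<dots> = \<epsilon> t \<odot> 1"
    using linear_Sinv by (simp add: antipode_left linear_self_iff Sinv_one)
  finally show ?thesis .
qed

lemma counit_t_imp_semisimple:
  assumes "\<epsilon> t \<noteq> 0"
  shows semisimple
proof -
  obtain Basis where "fd_coalgebra (\<odot>) \<Delta> \<epsilon> Basis" by (rule exists_basis)
  then interpret fd_coalgebra "(\<odot>)" \<Delta> \<epsilon> Basis .
  \<comment> \<open>The factor \<open>inverse (\<epsilon> t)\<close> normalises the Casimir element
    so that its product is \<open>1\<close>.\<close>
  let ?A = "\<lambda>i x. dual_left i * x" and ?B = "\<lambda>i x. (inverse (\<epsilon> t) \<odot> dual_right i) * x"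
  have lin: "Vector_Spaces.linear (\<odot>) (\<odot>) L" if "L \<in> range (*)" for L
    using that linear_mult(1) by auto
  have "\<exists>p. equivariant_projection (range (*)) V p" if "stable (range (*)) V" for V
  proof -
    have V: "subspace V" and st: "\<And>a x. x \<in> V \<Longrightarrow> a * x \<in> V"
      using that by (auto simp: stable_def)
    obtain p where p: "equivariant_projection {} V p"
      using exists_projection[OF V] .
    have "equivariant_projection (range (*) \<union> {}) V (\<lambda>x. \<Sum>i\<in>dual_index. ?B i (p (?A i x)))"
    proof (rule average_projection[OF p V])
      show "(\<Sum>i\<in>dual_index. ?B i (?A i x)) = x" for x
      proof -
        have "(\<Sum>i\<in>dual_index. ?B i (?A i x)) =
            inverse (\<epsilon> t) \<odot> ((\<Sum>i\<in>dual_index. dual_right i * dual_left i) * x)"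
          by (simp add: sum_distrib_right scale_sum_right mult_scale_left mult.assoc)
        then show ?thesis
          using assms by (simp add: sum_dual_right_left mult_scale_left)
      qed
      fix L :: "'h \<Rightarrow> 'h"
      assume "L \<in> range (*)"
      then obtain y where L: "L = (*) y" by blast
      \<comment> \<open>Left multiplication by \<open>y\<close> has the matrix of
        \<open>casimir\<close>: \<open>dual_bases\<close> gives it on \<open>?B\<close>,
        \<open>dual_bases'\<close> on \<open>?A\<close>.\<close>
      show "\<exists>m. \<forall>i\<in>dual_index. \<forall>x. L (?B i x) = (\<Sum>j\<in>dual_index. m j i \<odot> ?B j x) \<and>
          ?A i (L x) = (\<Sum>j\<in>dual_index. m i j \<odot> ?A j x)"
      proof (intro exI ballI allI conjI)
        fix i x
        have "L (?B i x) = inverse (\<epsilon> t) \<odot>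
            ((\<Sum>j\<in>dual_index. \<phi> (dual_left j * (y * dual_right i)) \<odot> dual_right j) * x)"
          unfolding dual_bases by (simp add: L mult_scale_left mult_scale_right mult.assoc)
        then show "L (?B i x) = (\<Sum>j\<in>dual_index. \<phi> (dual_left j * (y * dual_right i)) \<odot> ?B j x)"
          by (simp add: sum_distrib_right scale_sum_right mult_scale_left mult.commute)
        have "?A i (L x) =
            (\<Sum>j\<in>dual_index. \<phi> (dual_left i * y * dual_right j) \<odot> dual_left j) * x"
          unfolding dual_bases' by (simp add: L mult.assoc)
        then show "?A i (L x) = (\<Sum>j\<in>dual_index. \<phi> (dual_left i * (y * dual_right j)) \<odot> ?A j x)"
          by (simp add: sum_distrib_right mult_scale_left mult.assoc)
      qed
    qed (auto intro: linear_mult st)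
    then show ?thesis by auto
  qed
  from span_simple_stable[OF lin this] show ?thesis
    by (simp add: semisimple_def simple_stable_iff_left_ideal)
qed

lemma phi_one_imp_cosemisimple:
  assumes "\<phi> 1 \<noteq> 0"
  shows cosemisimple
proof -
  obtain Basis where "fd_coalgebra (\<odot>) \<Delta> \<epsilon> Basis" by (rule exists_basis)
  then interpret fd_coalgebra "(\<odot>)" \<Delta> \<epsilon> Basis .
  \<comment> \<open>Since \<open>b * Sinv a = Sinv (a * S b)\<close>, type \<open>S\<close> gives
    \<open>\<Sum> \<phi>(x\<^sub>2 S\<^sup>-\<^sup>1(x\<^sub>1)) = \<epsilon>(x)\<phi>(1)\<close>,
    hence the normalising factor.\<close>
  define \<sigma> where "\<sigma> x y = inverse (\<phi> 1) * \<phi> (x * Sinv y)" for x y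
  have phi_Sinv: "functional (\<lambda>x. \<phi> (Sinv x))"
    by (rule functional_comp[OF functional_phi linear_Sinv])
  show ?thesis
  proof (rule coseparable_imp_cosemisimple[of \<sigma>])
    show "functional (\<sigma> x)" for x
      using functional_comp[OF functional_phi_mult(1)[of x] linear_Sinv]
      by (simp add: \<sigma>_def[abs_def] linear_functional_iff algebra_simps)
    show "functional (\<lambda>x. \<sigma> x y)" for y
      using functional_phi_mult(2)[of "Sinv y"]
      by (simp add: \<sigma>_def[abs_def] linear_functional_iff algebra_simps)
    show "x \<leftharpoonup>\<^sub>c (\<lambda>z. \<sigma> z y) = \<sigma> x \<rightharpoonup>\<^sub>c y" for x y
      \<comment> \<open>A one-element index set specialises the sum rules to pulling out a
        scalar.\<close>
      using coact_sum[of x "\<lambda>_. inverse (\<phi> 1)" "\<lambda>_ z. \<phi> (z * Sinv y)" "{()}"]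
        lcoact_sum[of "\<lambda>_. inverse (\<phi> 1)" "\<lambda>_ z. \<phi> (x * Sinv z)" "{()}" y]
      by (simp add: \<sigma>_def[abs_def] coact_phi_Sinv)
    show "lin_ext (*) (\<lambda>(a, b). \<sigma> b a) (\<Delta> x) = \<epsilon> x" for x
    proof -
      have "lin_ext (*) (\<lambda>(a, b). \<sigma> b a) (\<Delta> x) =
          inverse (\<phi> 1) * \<phi> (Sinv (sweedler (\<lambda>a b. a * S b) x))"
        unfolding sweedler_def linear_lin_ext_comp[OF phi_Sinv]
        by (simp add: lin_ext_def case_prod_unfold Sinv_mult \<sigma>_def sum_distrib_left mult_ac)
      also have "\<dots> = \<epsilon> x"
        using assms linear_Sinv by (simp add: antipode_right linear_self_iff Sinv_one phi_simps)
      finally show ?thesis .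
    qed
  qed
qed

text \<open>When \<open>Sinv = S\<close>, the trace formula involves
  \<open>\<Sum> t\<^sub>1 S(t\<^sub>2)\<close>, which type \<open>S\<close> evaluates.\<close>

lemma involutive_imp_trace:
  assumes "S \<circ> S = id" "fd_coalgebra (\<odot>) \<Delta> \<epsilon> Basis"
  shows "of_nat (card Basis) = \<epsilon> t * \<phi> 1"
proof -
  have Sinv: "Sinv x = S x" for x
    using assms(1) Sinv_S[of "S x"] by (metis comp_apply id_apply)
  have "(\<Sum>i\<in>dual_index. dual_left i * dual_right i) = sweedler (\<lambda>a b. a * Sinv b) t"
    by (rule sum_dual) (rule linear_mult)
  then have "\<phi> (\<Sum>i\<in>dual_index. dual_left i * dual_right i) = \<epsilon> t * \<phi> 1"
    by (simp add: Sinv antipode_right phi_simps)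
  then show ?thesis
    using trace_id[OF assms(2)] by (simp add: phi_simps)
qed

lemma involutive_of_counit_t:
  assumes "\<epsilon> t \<noteq> 0" and sw: "sweedler (\<lambda>a b. S b * a) t = \<epsilon> t \<odot> 1"
  shows "S (S y) = y"
proof -
  have S2: "Vector_Spaces.linear (\<odot>) (\<odot>) (\<lambda>x. S (S x) * a)" for a
    using linear_S by (simp add: linear_self_iff algebra_simps mult_scale_left)
  have "(\<Sum>i\<in>dual_index. S (S (dual_right i)) * dual_left i) = \<epsilon> t \<odot> 1"
    using sum_dual[where B = "\<lambda>a b. S (S b) * a", OF S2] sw by simp
  \<comment> \<open>\<open>S \<circ> S\<close> preserves the order of products, so
    \<open>S (S y)\<close> splits off on the left; after \<open>casimir\<close>, \<open>y\<close>
    splits off on the right instead.\<close>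
  then have "\<epsilon> t \<odot> S (S y) = (\<Sum>i\<in>dual_index. S (S (y * dual_right i)) * dual_left i)"
    by (simp add: S_mult mult.assoc mult_scale_right flip: sum_distrib_left)
  also have "\<dots> = (\<Sum>i\<in>dual_index. S (S (dual_right i)) * (dual_left i * y))"
    by (rule casimir[where B = "\<lambda>a b. S (S b) * a", symmetric, OF S2 linear_mult(1)])
  also have "\<dots> = \<epsilon> t \<odot> y"
    using \<open>(\<Sum>i\<in>dual_index. S (S (dual_right i)) * dual_left i) = \<epsilon> t \<odot> 1\<close>
    by (simp add: mult_scale_left flip: mult.assoc sum_distrib_right)
  finally show ?thesis using assms(1) by simp
qed

end

theorem theorem2:
  fixes scale :: "'k::{alg_closed_field, field_char_0} \<Rightarrow> 'h::ring_1 \<Rightarrow> 'h"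
    and \<Delta> :: "'h \<Rightarrow> ('h \<times> 'h \<Rightarrow>\<^sub>0 'k)"
    and \<epsilon> :: "'h \<Rightarrow> 'k"
    and t :: 'h
    and \<phi> :: "'h \<Rightarrow> 'k"
    and S :: "'h \<Rightarrow> 'h"
  assumes "sbf_algebra scale \<Delta> \<epsilon> t \<phi>"
    and "S = algebra_coalgebra.antipode scale \<Delta> t \<phi>"
  shows "(S \<circ> S = id \<longrightarrow>
      k_algebra.semisimple scale \<and> coalgebra.cosemisimple scale \<Delta>) \<and>
    (k_algebra.semisimple scale \<and> coalgebra.cosemisimple scale \<Delta> \<and>
      coalgebra.sweedler scale \<Delta> (\<lambda>t1 t2. S t2 * t1) t = scale (\<epsilon> t) 1 \<longrightarrow>
      S \<circ> S = id)"
proof -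
  interpret H: sbf_algebra scale \<Delta> \<epsilon> t \<phi> by fact
  have S: "S = H.S" by fact
  have "H.semisimple \<and> H.cosemisimple" if "S \<circ> S = id"
  proof -
    obtain Basis where Basis: "fd_coalgebra scale \<Delta> \<epsilon> Basis" by (rule H.exists_basis)
    then interpret fd_coalgebra scale \<Delta> \<epsilon> Basis .
    \<comment> \<open>In a \<open>ring_1\<close> the unit is nonzero, so the dimension is positive,
      and in characteristic zero it stays nonzero as a scalar.\<close>
    have "Basis \<noteq> {}"
    proof
      assume "Basis = {}"
      then show False using sum_coord[of "1 :: 'h"] by simp
    qed
    then have "of_nat (card Basis) \<noteq> (0 :: 'k)" by (simp add: finite_Basis)
    moreover have "of_nat (card Basis) = \<epsilon> t * \<phi> 1"
      by (rule H.involutive_imp_trace[OF _ Basis]) (use that S in simp)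
    ultimately have "\<epsilon> t * \<phi> 1 \<noteq> 0" by metis
    then show ?thesis
      using H.counit_t_imp_semisimple H.phi_one_imp_cosemisimple by simp
  qed
  moreover have "S \<circ> S = id"
    if "H.semisimple" "H.sweedler (\<lambda>t1 t2. S t2 * t1) t = scale (\<epsilon> t) 1"
    using H.involutive_of_counit_t[OF H.semisimple_imp_counit_t[OF that(1)]] that(2)
    by (auto simp: S)
  ultimately show ?thesis by blast
qed

end
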